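(* Let $\mathcal{G}=(\mathcal{V},\mathcal{E})$ be a DAG containing a treatment $A$ and an outcome $Y$, and let the variables follow a linear Gaussian structural causal model Markov and faithful to $\mathcal{G}$, with all variables other than $A,Y$ pre-treatment. Let $K$ and $L$ be two adjustment sets (subsets of $\mathcal{V}\setminus\{A,Y\}$) for estimating the causal effect $\tau$ of $A$ on $Y$ with the ordinary least squares estimators $\hat\tau_K$ and $\hat\tau_L$ computed from $n$ i.i.d. samples, and assume $|K|<n-3$ and $|L|<n-3$. If $B^2(\hat\tau_K) > B^2(\hat\tau_L)$, then $E\{(\hat\tau_K-\tau)^2\} < E\{(\hat\tau_L-\tau)^2\}$ if and only if \[ n < \frac{\mathrm{aVar}(\hat\tau_L) - \left(\frac{n-|L|-3}{n-|K|-3}\right)\mathrm{aVar}(\hat\tau_K)}{B^2(\hat\tau_K)-B^2(\hat\tau_L)} + |L| + 3 . \]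
   Context: Setting: $\mathcal{G}=(\mathcal{V},\mathcal{E})$ is a directed acyclic graph over random variables $\mathcal{V}=\{V_1,\dots,V_d\}$ containing a treatment $A$ and outcome $Y$ with an edge $A\to Y$. The variables satisfy $V_i=\sum_{V_j\in \mathrm{Pa}(V_i,\mathcal{G})}\beta_{ij}V_j+\epsilon_i$ with jointly independent $\epsilon_i\sim\mathcal{N}(0,\sigma_i^2)$; the distribution is Markov and faithful to $\mathcal{G}$. Pre-treatment assumption: no variable in $\mathcal{V}\setminus\{A,Y\}$ is a descendant of $A$. The average treatment effect is $\tau=\frac{\partial}{\partial a}E\{Y\mid do(A=a)\}$ (the coefficient of $A$ in the equation for $Y$). For $K\subseteq\mathcal{V}\setminus\{A,Y\}$, $\hat\tau_K$ is the OLS coefficient of $A$ in the regression of $Y$ on $A$ and $K$ from $n$ i.i.d. observations. For sets of variables $X$, $\sigma_{yy.x}=\mathrm{var}(Y)-\mathrm{cov}(Y,X)\mathrm{cov}(X,X)^{-1}\mathrm{cov}(X,Y)$ (and analogously $\sigma_{aa.k}$, etc.; lowercase letters denote the corresponding variable sets). The asymptotic variance is $\mathrm{aVar}(\hat\tau_K)=\sigma_{yy.ak}/\sigma_{aa.k}$, and the bias is $B(\hat\tau_K)=E(\hat\tau_K)-\tau$. *)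

theory Defs
  imports "HOL-Probability.Probability" "Jordan_Normal_Form.Determinant"
begin

definition parents :: "('v \<times> 'v) set \<Rightarrow> 'v \<Rightarrow> 'v set" where
  "parents E v = {u. (u, v) \<in> E}"

definition is_dag :: "'v set \<Rightarrow> ('v \<times> 'v) set \<Rightarrow> bool" where
  "is_dag V E \<longleftrightarrow> finite V \<and> E \<subseteq> V \<times> V \<and> acyclic E"

definition descendants :: "('v \<times> 'v) set \<Rightarrow> 'v \<Rightarrow> 'v set" where
  "descendants E v = {w. (v, w) \<in> E\<^sup>*}"

definition is_path :: "('v \<times> 'v) set \<Rightarrow> 'v list \<Rightarrow> 'v \<Rightarrow> 'v \<Rightarrow> bool" where
  "is_path E p i j \<longleftrightarrow> length p \<ge> 2 \<and> distinct p \<and> hd p = i \<and> last p = j \<and>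
     (\<forall>k. Suc k < length p \<longrightarrow> (p ! k, p ! Suc k) \<in> E \<or> (p ! Suc k, p ! k) \<in> E)"

definition collider_at :: "('v \<times> 'v) set \<Rightarrow> 'v list \<Rightarrow> nat \<Rightarrow> bool" where
  "collider_at E p k \<longleftrightarrow> (p ! (k - 1), p ! k) \<in> E \<and> (p ! Suc k, p ! k) \<in> E"

definition path_blocked :: "('v \<times> 'v) set \<Rightarrow> 'v list \<Rightarrow> 'v set \<Rightarrow> bool" where
  "path_blocked E p S \<longleftrightarrow> (\<exists>k. 0 < k \<and> Suc k < length p \<and>
     ((\<not> collider_at E p k \<and> p ! k \<in> S) \<or>
      (collider_at E p k \<and> descendants E (p ! k) \<inter> S = {})))"

definition d_separated :: "('v \<times> 'v) set \<Rightarrow> 'v \<Rightarrow> 'v \<Rightarrow> 'v set \<Rightarrow> bool" where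
  "d_separated E i j S \<longleftrightarrow> (\<forall>p. is_path E p i j \<longrightarrow> path_blocked E p S)"

definition minv :: "real mat \<Rightarrow> real mat" where
  "minv A = (1 / det A) \<cdot>\<^sub>m adj_mat A"

definition cov :: "'a measure \<Rightarrow> ('a \<Rightarrow> real) \<Rightarrow> ('a \<Rightarrow> real) \<Rightarrow> real" where
  "cov M U W = prob_space.expectation M (\<lambda>\<omega>. (U \<omega> - prob_space.expectation M U) *
                                           (W \<omega> - prob_space.expectation M W))"

definition cov_mat :: "('v \<Rightarrow> 'v \<Rightarrow> real) \<Rightarrow> 'v list \<Rightarrow> 'v list \<Rightarrow> real mat" where
  "cov_mat Sig xs ys = mat (length xs) (length ys) (\<lambda>(r, c). Sig (xs ! r) (ys ! c))"

definition partial_cov :: "('v::linorder \<Rightarrow> 'v \<Rightarrow> real) \<Rightarrow> 'v \<Rightarrow> 'v \<Rightarrow> 'v set \<Rightarrow> real" where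
  "partial_cov Sig u w X =
     (let xs = sorted_list_of_set X in
      Sig u w - (cov_mat Sig [u] xs * minv (cov_mat Sig xs xs) * cov_mat Sig xs [w]) $$ (0, 0))"

definition gaussian_faithful :: "'v::linorder set \<Rightarrow> ('v \<times> 'v) set \<Rightarrow> ('v \<Rightarrow> 'v \<Rightarrow> real) \<Rightarrow> bool" where
  "gaussian_faithful V E Sig \<longleftrightarrow>
     (\<forall>i\<in>V. \<forall>j\<in>V. \<forall>S. S \<subseteq> V - {i, j} \<longrightarrow> i \<noteq> j \<longrightarrow>
        partial_cov Sig i j S = 0 \<longrightarrow> d_separated E i j S)"

definition ols_coef :: "nat \<Rightarrow> (nat \<Rightarrow> 'v::linorder \<Rightarrow> real) \<Rightarrow> 'v \<Rightarrow> 'v \<Rightarrow> 'v set \<Rightarrow> real" where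
  "ols_coef n x A Y K =
     (let ks = sorted_list_of_set K;
          D = mat n (length ks + 2) (\<lambda>(t, c). if c = 0 then 1 else if c = 1 then x t A
                                               else x t (ks ! (c - 2)));
          y = vec n (\<lambda>t. x t Y);
          b = minv (transpose_mat D * D) *\<^sub>v (transpose_mat D *\<^sub>v y)
      in b $ 1)"

end

(*
  The claim reduces to the exact formula
    E (tauhat_S - tau)^2 = B_S^2 + aVar_S / (n - |S| - 3),
  after which it is a rearrangement of an inequality.  The observations are linear forms in
  independent standard normal variables.  Let r be the residual of the column A after projecting out
  the intercept and the columns of S, and let w be the noise of the population regression of Y on A
  and S.  Almost surely tauhat_S - b = <r, w> / <r, r>, where b is the population coefficient of A.

  All distributional facts come from the Cameron-Martin formula for translations of the Gaussian
  measure, so neither multivariate normal laws nor the chi-squared distribution are needed.  A function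
  that is invariant under the translations in direction c behaves as if it were independent of the
  linear form c, which gives mean 0 and second moment var(w) E(1/<r, r>).  Stein's identity for the
  vector field r / (<r, r> + delta), whose divergence involves the trace n - 1 - |S| of the projection,
  gives E(1/<r, r>) = 1 / (sigma_aa.s (n - |S| - 3)) as delta tends to 0.  Finally <r, r> > 0 almost
  surely, because a set that meets every line in a fixed direction at most once is null.
*)
theory Submission
  imports Defs
begin

section \<open>Translations of the standard Gaussian measure\<close>

text \<open>Everything hinges on the directions of translation. Let e be the population residual of
  A given S. Shifting one observation t along e fixes the columns of S, hence the projection P, and
  moves r along column t of P. Shifting along w fixes A as well, hence r itself. Put q = <r, r>, v =
  sigma_aa.s and m = n - 1 - |S|. Where q > 0, the derivatives of r_t / q along e in row t sum over
  t to v (m / q - 2 q / q^2) = v (m - 2) / q, while the linear forms paired with them add up to <r,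
  r> / q = 1. So 1 = v (m - 2) E(1/q): the 3 is one for the intercept plus two from differentiating
  q, and n > |S| + 3 says m > 2. The obstacle is that r / q is unbounded near q = 0, so finiteness
  of E(1/q) must come out of the argument instead of entering it; a denominator q + delta keeps the
  field and its derivative bounded. A second obstacle is that \<open>ols_coef\<close> uses an
  adjugate formula, which is a true inverse only for designs of full rank, so full rank must first
  be shown almost surely.\<close>

definition gauss :: "'i set \<Rightarrow> ('i \<Rightarrow> real) measure" where
  "gauss I = PiM I (\<lambda>_. density lborel std_normal_density)"

definition lin_form :: "'i set \<Rightarrow> ('i \<Rightarrow> real) \<Rightarrow> ('i \<Rightarrow> real) \<Rightarrow> real" where
  "lin_form I c x = (\<Sum>i\<in>I. c i * x i)"

definition translate :: "'i set \<Rightarrow> ('i \<Rightarrow> real) \<Rightarrow> real \<Rightarrow> ('i \<Rightarrow> real) \<Rightarrow> ('i \<Rightarrow> real)" where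
  "translate I c h x = (\<lambda>i\<in>I. x i + h * c i)"

lemma prob_space_gauss: "prob_space (gauss I)"
  unfolding gauss_def by (intro prob_space_PiM prob_space_normal_density) simp

lemma sets_gauss [measurable_cong]: "sets (gauss I) = sets (PiM I (\<lambda>_. borel))"
  unfolding gauss_def by (intro sets_PiM_cong) auto

lemma space_gauss: "space (gauss I) = (\<Pi>\<^sub>E i\<in>I. UNIV)"
  unfolding gauss_def by (simp add: space_PiM)

lemma lin_form_measurable [measurable]: "lin_form I c \<in> borel_measurable (gauss I)"
  unfolding lin_form_def[abs_def] by measurable

lemma translate_measurable [measurable]: "translate I c h \<in> measurable (gauss I) (gauss I)"
  unfolding translate_def[abs_def] by measurable

lemma translate_in_space: "translate I c h x \<in> space (gauss I)"
  by (auto simp: translate_def space_gauss)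

lemma translate_translate: "translate I c h (translate I c k x) = translate I c (h + k) x"
  by (auto simp: translate_def fun_eq_iff algebra_simps)

lemma translate_zero: "x \<in> space (gauss I) \<Longrightarrow> translate I c 0 x = x"
  by (auto simp: translate_def space_gauss fun_eq_iff PiE_def extensional_def)

lemma lin_form_translate: "lin_form I d (translate I c h x) = lin_form I d x + h * (\<Sum>i\<in>I. d i * c i)"
  by (simp add: lin_form_def translate_def sum.distrib sum_distrib_left algebra_simps)

lemma lin_form_scale: "lin_form I (\<lambda>i. a * c i) x = a * lin_form I c x"
  by (simp add: lin_form_def sum_distrib_left algebra_simps)

text \<open>Completing the square: after the substitution of d + x for x, the exponential weight
  turns the density at d + x back into the density at x.\<close>

lemma normal_shift_1d:
  fixes d :: real
  assumes [measurable]: "A \<in> sets borel"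
  shows "(\<integral>\<^sup>+x. ennreal (exp (d * x - d\<^sup>2 / 2)) * indicator A x \<partial>density lborel std_normal_density)
       = emeasure (density lborel std_normal_density) {x. x + d \<in> A}"
proof -
  have "(\<integral>\<^sup>+x. ennreal (exp (d * x - d\<^sup>2 / 2)) * indicator A x \<partial>density lborel std_normal_density)
      = (\<integral>\<^sup>+x. ennreal (std_normal_density x) * (ennreal (exp (d * x - d\<^sup>2 / 2)) * indicator A x) \<partial>lborel)"
    by (subst nn_integral_density) auto
  also have "\<dots> = (\<integral>\<^sup>+x. ennreal (std_normal_density (d + 1 * x)) * (ennreal (exp (d * (d + 1 * x) - d\<^sup>2 / 2)) * indicator A (d + 1 * x)) \<partial>lborel)"
    by (subst nn_integral_real_affine[where c = 1 and t = d]) auto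
  also have "\<dots> = (\<integral>\<^sup>+x. ennreal (std_normal_density x) * indicator {x. x + d \<in> A} x \<partial>lborel)"
  proof (intro nn_integral_cong)
    fix x :: real
    have "std_normal_density (d + 1 * x) * exp (d * (d + 1 * x) - d\<^sup>2 / 2) = std_normal_density x"
      by (simp add: std_normal_density_def mult_exp_exp power2_eq_square field_simps)
    then have "ennreal (std_normal_density (d + 1 * x)) * ennreal (exp (d * (d + 1 * x) - d\<^sup>2 / 2)) = ennreal (std_normal_density x)"
      by (subst ennreal_mult[symmetric]) auto
    then show "ennreal (std_normal_density (d + 1 * x)) * (ennreal (exp (d * (d + 1 * x) - d\<^sup>2 / 2)) * indicator A (d + 1 * x))
      = ennreal (std_normal_density x) * indicator {x. x + d \<in> A} x"
      by (auto simp: indicator_def add.commute mult.assoc[symmetric])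
  qed
  also have "\<dots> = emeasure (density lborel std_normal_density) {x. x + d \<in> A}"
    by (subst emeasure_density) auto
  finally show ?thesis .
qed

text \<open>Both measures agree on boxes with the product of the shifted one-dimensional laws. For
  the density this is because the exponential of a sum factorises over the coordinates, which
  reduces the claim to \<open>normal_shift_1d\<close>.\<close>

lemma cameron_martin:
  assumes I: "finite I"
  shows "distr (gauss I) (gauss I) (translate I c 1)
       = density (gauss I) (\<lambda>x. ennreal (exp (lin_form I c x - (\<Sum>i\<in>I. (c i)\<^sup>2) / 2)))" (is "?L = ?R")
proof -
  let ?N = "\<lambda>_::'a. density lborel std_normal_density"
  interpret N: prob_space "?N i" for i by (rule prob_space_normal_density) simp
  interpret product_sigma_finite ?N ..
  let ?M = "\<lambda>i. distr (?N i) borel (\<lambda>x. x + c i)"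
  interpret M: prob_space "?M i" for i by (rule N.prob_space_distr) auto
  interpret M: product_sigma_finite ?M ..
  have L: "?L = PiM I ?M"
  proof (rule M.PiM_eqI[OF I])
    show "sets ?L = sets (PiM I ?M)"
      by (simp add: sets_gauss) (intro sets_PiM_cong; simp)
    fix A assume "\<And>i. i \<in> I \<Longrightarrow> A i \<in> sets (?M i)"
    then have A[measurable]: "\<And>i. i \<in> I \<Longrightarrow> A i \<in> sets borel" by simp
    have "emeasure ?L (Pi\<^sub>E I A) = emeasure (gauss I) (translate I c 1 -` Pi\<^sub>E I A \<inter> space (gauss I))"
      using I by (intro emeasure_distr) (auto simp: sets_gauss intro!: sets_PiM_I_finite)
    also have "translate I c 1 -` Pi\<^sub>E I A \<inter> space (gauss I) = Pi\<^sub>E I (\<lambda>i. {x. x + c i \<in> A i})"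
      by (auto simp: translate_def space_gauss PiE_def Pi_def extensional_def)
    also have "emeasure (gauss I) \<dots> = (\<Prod>i\<in>I. emeasure (?N i) {x. x + c i \<in> A i})"
      unfolding gauss_def using I by (intro emeasure_PiM) auto
    also have "\<dots> = (\<Prod>i\<in>I. emeasure (?M i) (A i))"
      by (intro prod.cong refl, subst emeasure_distr) (auto simp: vimage_def)
    finally show "emeasure ?L (Pi\<^sub>E I A) = (\<Prod>i\<in>I. emeasure (?M i) (A i))" .
  qed
  have R: "?R = PiM I ?M"
  proof (rule M.PiM_eqI[OF I])
    show "sets ?R = sets (PiM I ?M)"
      by (simp add: sets_gauss) (intro sets_PiM_cong; simp)
    fix A assume "\<And>i. i \<in> I \<Longrightarrow> A i \<in> sets (?M i)"
    then have A[measurable]: "\<And>i. i \<in> I \<Longrightarrow> A i \<in> sets borel" by simp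
    have "emeasure ?R (Pi\<^sub>E I A) = (\<integral>\<^sup>+x. ennreal (exp (lin_form I c x - (\<Sum>i\<in>I. (c i)\<^sup>2) / 2)) * indicator (Pi\<^sub>E I A) x \<partial>gauss I)"
      using I by (intro emeasure_density) (auto simp: sets_gauss intro!: sets_PiM_I_finite)
    also have "\<dots> = (\<integral>\<^sup>+x. (\<Prod>i\<in>I. ennreal (exp (c i * x i - (c i)\<^sup>2 / 2)) * indicator (A i) (x i)) \<partial>gauss I)"
    proof (intro nn_integral_cong)
      fix x assume x: "x \<in> space (gauss I)"
      have 1: "exp (lin_form I c x - (\<Sum>i\<in>I. (c i)\<^sup>2) / 2) = (\<Prod>i\<in>I. exp (c i * x i - (c i)\<^sup>2 / 2))"
        using I by (simp add: exp_sum[symmetric] lin_form_def sum_subtractf sum_divide_distrib)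
      have 2: "indicator (Pi\<^sub>E I A) x = (\<Prod>i\<in>I. indicator (A i) (x i) :: ennreal)"
        using x I by (auto simp: indicator_def space_gauss PiE_def Pi_def prod_zero_iff intro!: prod.neutral)
      show "ennreal (exp (lin_form I c x - (\<Sum>i\<in>I. (c i)\<^sup>2) / 2)) * indicator (Pi\<^sub>E I A) x
         = (\<Prod>i\<in>I. ennreal (exp (c i * x i - (c i)\<^sup>2 / 2)) * indicator (A i) (x i))"
        unfolding 1 2 by (simp add: prod.distrib prod_ennreal)
    qed
    also have "\<dots> = (\<Prod>i\<in>I. \<integral>\<^sup>+x. ennreal (exp (c i * x - (c i)\<^sup>2 / 2)) * indicator (A i) x \<partial>?N i)"
      unfolding gauss_def using I by (intro product_nn_integral_prod) auto
    also have "\<dots> = (\<Prod>i\<in>I. emeasure (?M i) (A i))"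
      by (intro prod.cong refl, subst normal_shift_1d, simp, subst emeasure_distr) (auto simp: vimage_def)
    finally show "emeasure ?R (Pi\<^sub>E I A) = (\<Prod>i\<in>I. emeasure (?M i) (A i))" .
  qed
  show ?thesis using L R by simp
qed

text \<open>The Cameron-Martin density for the shift \<open>h * c\<close>. The step \<open>h\<close>
  is kept apart from \<open>c\<close> because the weight will be differentiated in \<open>h\<close>
  at 0, where its derivative is \<open>lin_form I c\<close>.\<close>

definition cm_weight :: "'i set \<Rightarrow> ('i \<Rightarrow> real) \<Rightarrow> real \<Rightarrow> ('i \<Rightarrow> real) \<Rightarrow> real" where
  "cm_weight I c h x = exp (h * lin_form I c x - h\<^sup>2 * (\<Sum>i\<in>I. (c i)\<^sup>2) / 2)"

lemma cm_weight_measurable [measurable]: "cm_weight I c h \<in> borel_measurable (gauss I)"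
  unfolding cm_weight_def[abs_def] by measurable

lemma cameron_martin_weight:
  assumes I: "finite I"
  shows "distr (gauss I) (gauss I) (translate I c h) = density (gauss I) (\<lambda>x. ennreal (cm_weight I c h x))"
  using cameron_martin[OF I, of "\<lambda>i. h * c i"]
  by (simp add: cm_weight_def lin_form_scale power_mult_distrib sum_distrib_left mult.commute
      translate_def[abs_def])

lemma
  fixes F :: "('i \<Rightarrow> real) \<Rightarrow> real"
  assumes I: "finite I" and F [measurable]: "F \<in> borel_measurable (gauss I)"
  shows cm_integrable: "integrable (gauss I) (\<lambda>x. F x * cm_weight I c h x) \<longleftrightarrow> integrable (gauss I) (\<lambda>x. F (translate I c h x))"
    and cm_integral: "(\<integral>x. F x * cm_weight I c h x \<partial>gauss I) = (\<integral>x. F (translate I c h x) \<partial>gauss I)"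
proof -
  have D: "distr (gauss I) (gauss I) (translate I c h) = density (gauss I) (\<lambda>x. ennreal (cm_weight I c h x))"
    by (rule cameron_martin_weight[OF I])
  have p: "AE x in gauss I. 0 \<le> cm_weight I c h x" by (simp add: cm_weight_def)
  have "integrable (gauss I) (\<lambda>x. F (translate I c h x)) \<longleftrightarrow> integrable (distr (gauss I) (gauss I) (translate I c h)) F"
    by (rule integrable_distr_eq[symmetric]) auto
  also have "\<dots> \<longleftrightarrow> integrable (gauss I) (\<lambda>x. cm_weight I c h x *\<^sub>R F x)"
    unfolding D by (rule integrable_density) (use p in auto)
  finally show "integrable (gauss I) (\<lambda>x. F x * cm_weight I c h x) \<longleftrightarrow> integrable (gauss I) (\<lambda>x. F (translate I c h x))"
    by (simp add: mult.commute)
  have "(\<integral>x. F (translate I c h x) \<partial>gauss I) = (\<integral>x. F x \<partial>distr (gauss I) (gauss I) (translate I c h))"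
    by (rule integral_distr[symmetric]) auto
  also have "\<dots> = (\<integral>x. cm_weight I c h x *\<^sub>R F x \<partial>gauss I)"
    unfolding D by (rule integral_density) (use p in auto)
  finally show "(\<integral>x. F x * cm_weight I c h x \<partial>gauss I) = (\<integral>x. F (translate I c h x) \<partial>gauss I)"
    by (simp add: mult.commute)
qed

text \<open>Restricted to the space because \<open>translate\<close> is \<open>undefined\<close> off
  \<open>I\<close>: on a function that is not extensional even \<open>translate I c 0\<close> is not
  the identity.\<close>

definition invariant :: "'i set \<Rightarrow> ('i \<Rightarrow> real) \<Rightarrow> (('i \<Rightarrow> real) \<Rightarrow> 'b) \<Rightarrow> bool" where
  "invariant I c F \<longleftrightarrow> (\<forall>x\<in>space (gauss I). \<forall>h. F (translate I c h x) = F x)"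

lemma invariantD: "invariant I c F \<Longrightarrow> x \<in> space (gauss I) \<Longrightarrow> F (translate I c h x) = F x"
  by (simp add: invariant_def)

text \<open>Multiplying by \<open>cm_weight\<close> amounts to translating, and \<open>F\<close>
  does not notice the translation. Hence exponential moments along \<open>c\<close> come for free
  from integrability of \<open>F\<close>.\<close>

lemma integrable_exp_lin_form:
  fixes F :: "('i \<Rightarrow> real) \<Rightarrow> real"
  assumes I: "finite I" and F: "integrable (gauss I) F" and inv: "invariant I c F"
  shows "integrable (gauss I) (\<lambda>x. F x * exp (a * lin_form I c x))"
proof -
  have [measurable]: "F \<in> borel_measurable (gauss I)" using F by auto
  have "integrable (gauss I) (\<lambda>x. F (translate I c a x)) \<longleftrightarrow> integrable (gauss I) F"
    using inv by (intro Bochner_Integration.integrable_cong) (auto simp: invariant_def)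
  then have "integrable (gauss I) (\<lambda>x. F x * cm_weight I c a x)"
    using F by (simp add: cm_integrable[OF I])
  then have "integrable (gauss I) (\<lambda>x. F x * cm_weight I c a x * exp (a\<^sup>2 * (\<Sum>i\<in>I. (c i)\<^sup>2) / 2))"
    by (rule integrable_mult_left)
  then show ?thesis
    by (simp add: cm_weight_def mult.assoc mult_exp_exp)
qed

lemma integrable_exp_abs_lin_form:
  fixes F :: "('i \<Rightarrow> real) \<Rightarrow> real"
  assumes I: "finite I" and F: "integrable (gauss I) F" and inv: "invariant I c F"
  shows "integrable (gauss I) (\<lambda>x. F x * exp (a * \<bar>lin_form I c x\<bar>))"
proof (rule Bochner_Integration.integrable_bound)
  have [measurable]: "F \<in> borel_measurable (gauss I)" using F by auto
  have "integrable (gauss I) (\<lambda>x. F x * exp (a * lin_form I c x))" "integrable (gauss I) (\<lambda>x. F x * exp (- a * lin_form I c x))"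
    by (intro integrable_exp_lin_form assms)+
  then show "integrable (gauss I) (\<lambda>x. \<bar>F x * exp (a * lin_form I c x)\<bar> + \<bar>F x * exp (- a * lin_form I c x)\<bar>)"
    by (intro Bochner_Integration.integrable_add integrable_abs)
  show "AE x in gauss I. norm (F x * exp (a * \<bar>lin_form I c x\<bar>)) \<le> norm (\<bar>F x * exp (a * lin_form I c x)\<bar> + \<bar>F x * exp (- a * lin_form I c x)\<bar>)"
    by (auto simp: abs_mult abs_if)
qed (use F in auto)

text \<open>A majorant, uniform in \<open>h\<close>, for the difference quotients of
  \<open>cm_weight\<close>. It rests on |exp y - 1| <= |y| exp |y| with |y| <= h (|w| + v). The
  factor |w| + v is absorbed by a second exp (|w| + v), whence the 2 in both exponents.\<close>

lemma exp_quotient_bound: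
  fixes w v h :: real
  assumes h: "0 < h" "h \<le> 1" and v: "0 \<le> v"
  shows "\<bar>(exp (h * w - h\<^sup>2 * v / 2) - 1) / h\<bar> \<le> exp (2 * v) * exp (2 * \<bar>w\<bar>)"
proof -
  define y where "y = h * w - h\<^sup>2 * v / 2"
  have hv: "0 \<le> h\<^sup>2 * v" using v by simp
  have "\<bar>h * w\<bar> = h * \<bar>w\<bar>" using h by (simp add: abs_mult)
  then have "\<bar>y\<bar> \<le> h * \<bar>w\<bar> + h\<^sup>2 * v / 2"
    using hv unfolding y_def by linarith
  also have "\<dots> \<le> h * \<bar>w\<bar> + h * v"
  proof -
    have "h * (h * v) \<le> 1 * (h * v)" using h v by (intro mult_right_mono) auto
    then have "h\<^sup>2 * v \<le> h * v" by (simp add: power2_eq_square mult.assoc)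
    then show ?thesis using hv by linarith
  qed
  finally have y: "\<bar>y\<bar> \<le> h * (\<bar>w\<bar> + v)" by (simp add: algebra_simps)
  have y1: "\<bar>y\<bar> \<le> \<bar>w\<bar> + v"
    using y h v mult_left_le_one_le[of "\<bar>w\<bar> + v" h] by linarith
  have "\<bar>exp y - 1\<bar> \<le> \<bar>y\<bar> * exp \<bar>y\<bar>"
  proof (cases "0 \<le> y")
    case True
    have "1 - y \<le> exp (- y)" using exp_ge_add_one_self[of "-y"] by simp
    then have "(1 - y) * exp y \<le> exp (- y) * exp y" by (rule mult_right_mono) simp
    then show ?thesis using True by (simp add: algebra_simps mult_exp_exp)
  next
    case False
    have "1 - exp y \<le> - y" using exp_ge_add_one_self[of y] by linarith
    also have "\<dots> \<le> - y * exp (- y)" using False by simp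
    finally show ?thesis using False by simp
  qed
  also have "\<dots> \<le> h * (\<bar>w\<bar> + v) * exp (\<bar>w\<bar> + v)"
    using y y1 by (intro mult_mono) auto
  also have "\<dots> \<le> h * exp (\<bar>w\<bar> + v) * exp (\<bar>w\<bar> + v)"
    using h exp_ge_add_one_self[of "\<bar>w\<bar> + v"] by (intro mult_right_mono mult_left_mono; linarith?) auto
  also have "\<dots> = h * (exp (2 * v) * exp (2 * \<bar>w\<bar>))"
    by (simp add: mult_exp_exp)
  finally show ?thesis
    using h by (simp add: y_def abs_mult field_simps)
qed

lemma translate_derivative_limit:
  fixes F :: "('i \<Rightarrow> real) \<Rightarrow> real" and h :: "nat \<Rightarrow> real"
  assumes I: "finite I" and F [measurable]: "F \<in> borel_measurable (gauss I)"
    and int: "integrable (gauss I) (\<lambda>x. F x * exp (2 * \<bar>lin_form I c x\<bar>))"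
    and h: "\<And>k. 0 < h k" "\<And>k. h k \<le> 1" "h \<longlonglongrightarrow> 0"
  shows "integrable (gauss I) F" "integrable (gauss I) (\<lambda>x. F x * lin_form I c x)"
    "integrable (gauss I) (\<lambda>x. F (translate I c (h k) x))"
    "(\<lambda>k. \<integral>x. (F (translate I c (h k) x) - F x) / h k \<partial>gauss I) \<longlonglongrightarrow> (\<integral>x. F x * lin_form I c x \<partial>gauss I)"
proof -
  define v where "v = (\<Sum>i\<in>I. (c i)\<^sup>2)"
  have v: "0 \<le> v" by (simp add: v_def sum_nonneg)
  show iF: "integrable (gauss I) F"
    by (rule Bochner_Integration.integrable_bound[OF int]) (auto simp: abs_mult mult_le_cancel_left1)
  show iFW: "integrable (gauss I) (\<lambda>x. F x * lin_form I c x)"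
  proof (rule Bochner_Integration.integrable_bound[OF int])
    have "\<bar>w\<bar> \<le> exp (2 * \<bar>w\<bar>)" for w :: real using exp_ge_add_one_self[of "2 * \<bar>w\<bar>"] by linarith
    then show "AE x in gauss I. norm (F x * lin_form I c x) \<le> norm (F x * exp (2 * \<bar>lin_form I c x\<bar>))"
      by (auto simp: abs_mult intro!: mult_left_mono)
  qed auto
  let ?g = "\<lambda>k x. F x * ((cm_weight I c (h k) x - 1) / h k)"
  let ?d = "\<lambda>x. exp (2 * v) * \<bar>F x * exp (2 * \<bar>lin_form I c x\<bar>)\<bar>"
  have d: "integrable (gauss I) ?d" using int by (intro integrable_mult_right integrable_abs)
  have bd: "norm (?g k x) \<le> ?d x" for k x
  proof -
    have "\<bar>F x\<bar> * \<bar>(cm_weight I c (h k) x - 1) / h k\<bar> \<le> \<bar>F x\<bar> * (exp (2 * v) * exp (2 * \<bar>lin_form I c x\<bar>))"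
      using exp_quotient_bound[OF h(1)[of k] h(2)[of k] v, of "lin_form I c x"]
      unfolding cm_weight_def v_def[symmetric] by (intro mult_left_mono) auto
    then show ?thesis by (simp add: abs_mult mult.left_commute)
  qed
  have ig: "integrable (gauss I) (?g k)" for k
    by (rule Bochner_Integration.integrable_bound[OF d]) (use bd in \<open>auto intro: order.trans\<close>)
  have iw: "integrable (gauss I) (\<lambda>x. F x * cm_weight I c (h k) x)" for k
  proof -
    have "integrable (gauss I) (\<lambda>x. ?g k x * h k + F x)"
      using ig iF by (intro Bochner_Integration.integrable_add integrable_mult_left)
    also have "(\<lambda>x. ?g k x * h k + F x) = (\<lambda>x. F x * cm_weight I c (h k) x)"
      using h(1)[of k] by (auto simp: field_simps)
    finally show ?thesis .
  qed
  show iS: "integrable (gauss I) (\<lambda>x. F (translate I c (h k) x))" for k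
    using iw cm_integrable[OF I F] by blast
  have eq: "(\<integral>x. (F (translate I c (h k) x) - F x) / h k \<partial>gauss I) = (\<integral>x. ?g k x \<partial>gauss I)" for k
  proof -
    have "(\<integral>x. (F (translate I c (h k) x) - F x) / h k \<partial>gauss I) = ((\<integral>x. F (translate I c (h k) x) \<partial>gauss I) - (\<integral>x. F x \<partial>gauss I)) / h k"
      using iS iF by simp
    also have "\<dots> = ((\<integral>x. F x * cm_weight I c (h k) x \<partial>gauss I) - (\<integral>x. F x \<partial>gauss I)) / h k"
      by (simp add: cm_integral[OF I F])
    also have "\<dots> = (\<integral>x. (F x * cm_weight I c (h k) x - F x) / h k \<partial>gauss I)"
      using iw iF by simp
    also have "\<dots> = (\<integral>x. ?g k x \<partial>gauss I)" by (simp add: algebra_simps diff_divide_distrib)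
    finally show ?thesis .
  qed
  have "(\<lambda>k. \<integral>x. ?g k x \<partial>gauss I) \<longlonglongrightarrow> (\<integral>x. F x * lin_form I c x \<partial>gauss I)"
  proof (rule integral_dominated_convergence[OF _ _ d])
    show "AE x in gauss I. (\<lambda>k. ?g k x) \<longlonglongrightarrow> F x * lin_form I c x"
    proof (rule AE_I2, rule tendsto_mult[OF tendsto_const])
      fix x :: "'i \<Rightarrow> real"
      have "((\<lambda>h. exp (h * lin_form I c x - h\<^sup>2 * v / 2)) has_field_derivative lin_form I c x) (at 0)"
        by (auto intro!: derivative_eq_intros)
      then have "(\<lambda>t. (exp (t * lin_form I c x - t\<^sup>2 * v / 2) - 1) / t) \<midarrow>0\<rightarrow> lin_form I c x"
        by (simp add: has_field_derivative_iff)
      moreover have "filterlim h (at 0) sequentially"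
        using h(1,3) by (intro filterlim_atI) (auto intro!: always_eventually simp: less_imp_neq[THEN not_sym])
      ultimately show "(\<lambda>k. (cm_weight I c (h k) x - 1) / h k) \<longlonglongrightarrow> lin_form I c x"
        unfolding cm_weight_def v_def[symmetric] by (rule filterlim_compose)
    qed
  qed (use bd in auto)
  then show "(\<lambda>k. \<integral>x. (F (translate I c (h k) x) - F x) / h k \<partial>gauss I) \<longlonglongrightarrow> (\<integral>x. F x * lin_form I c x \<partial>gauss I)"
    unfolding eq .
qed

section \<open>Gaussian integration by parts\<close>

lemma inverse_Suc_null_sequence: "0 < inverse (real (Suc k))" "inverse (real (Suc k)) \<le> 1" "(\<lambda>k. inverse (real (Suc k))) \<longlonglongrightarrow> 0"
  using LIMSEQ_inverse_real_of_nat by (auto simp: inverse_eq_divide)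

text \<open>The limit \<open>D\<close> is left open because it arises in three ways below: the
  quotients of \<open>F\<close> vanish identically, have a constant integral, or converge boundedly
  to a derivative.\<close>

lemma gaussian_ibp:
  fixes F :: "('i \<Rightarrow> real) \<Rightarrow> real"
  assumes I: "finite I" and F [measurable]: "F \<in> borel_measurable (gauss I)"
    and int: "integrable (gauss I) (\<lambda>x. F x * exp (2 * \<bar>lin_form I c x\<bar>))"
    and lim: "(\<lambda>k. \<integral>x. (F (translate I c (inverse (real (Suc k))) x) - F x) / inverse (real (Suc k)) \<partial>gauss I) \<longlonglongrightarrow> D"
  shows "(\<integral>x. F x * lin_form I c x \<partial>gauss I) = D"
  using translate_derivative_limit(4)[OF I F int inverse_Suc_null_sequence] lim by (rule LIMSEQ_unique)

lemma integral_invariant_lin_form: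
  fixes F :: "('i \<Rightarrow> real) \<Rightarrow> real"
  assumes I: "finite I" and F: "integrable (gauss I) F" and inv: "invariant I c F"
  shows "integrable (gauss I) (\<lambda>x. F x * lin_form I c x)" "(\<integral>x. F x * lin_form I c x \<partial>gauss I) = 0"
proof -
  have [measurable]: "F \<in> borel_measurable (gauss I)" using F by auto
  have int: "integrable (gauss I) (\<lambda>x. F x * exp (2 * \<bar>lin_form I c x\<bar>))"
    by (rule integrable_exp_abs_lin_form[OF assms])
  show "integrable (gauss I) (\<lambda>x. F x * lin_form I c x)"
    by (rule translate_derivative_limit(2)[OF I _ int inverse_Suc_null_sequence]) auto
  have z: "(\<integral>x. (F (translate I c h x) - F x) / h \<partial>gauss I) = 0" for h
    using inv by (subst Bochner_Integration.integral_cong[OF refl, of _ _ "\<lambda>_. 0"]) (auto simp: invariant_def)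
  show "(\<integral>x. F x * lin_form I c x \<partial>gauss I) = 0"
    by (rule gaussian_ibp[OF I _ int]) (simp_all only: z tendsto_const \<open>F \<in> borel_measurable (gauss I)\<close>)
qed

text \<open>Integrate by parts along \<open>c\<close>, applied to \<open>F\<close> times the form
  \<open>d\<close>. As \<open>F\<close> is invariant and the form is linear, every difference
  quotient equals exactly <d, c> F.\<close>

lemma integral_invariant_lin_form_lin_form:
  fixes F :: "('i \<Rightarrow> real) \<Rightarrow> real"
  assumes I: "finite I" and F: "integrable (gauss I) F" and inv: "invariant I c F" "invariant I d F"
  shows "integrable (gauss I) (\<lambda>x. F x * lin_form I d x * lin_form I c x)"
    "(\<integral>x. F x * lin_form I d x * lin_form I c x \<partial>gauss I) = (\<Sum>i\<in>I. d i * c i) * (\<integral>x. F x \<partial>gauss I)"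
proof -
  have [measurable]: "F \<in> borel_measurable (gauss I)" using F by auto
  have "integrable (gauss I) (\<lambda>x. F x * exp (2 * \<bar>lin_form I d x\<bar>))" "integrable (gauss I) (\<lambda>x. F x * exp (4 * \<bar>lin_form I c x\<bar>))"
    by (intro integrable_exp_abs_lin_form assms)+
  then have s: "integrable (gauss I) (\<lambda>x. \<bar>F x * exp (2 * \<bar>lin_form I d x\<bar>)\<bar> + \<bar>F x * exp (4 * \<bar>lin_form I c x\<bar>)\<bar>)"
    by (intro Bochner_Integration.integrable_add integrable_abs)
  have int: "integrable (gauss I) (\<lambda>x. F x * lin_form I d x * exp (2 * \<bar>lin_form I c x\<bar>))"
  proof (rule Bochner_Integration.integrable_bound[OF s])
    \<comment> \<open>Exponential moments are available for each of the two forms separately. This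
      inequality, from xy <= x^2 + y^2, splits the mixed product accordingly; squaring doubles the
      exponent 2 to 4.\<close>
    have "\<bar>a\<bar> * exp (2 * \<bar>b\<bar>) \<le> exp (2 * \<bar>a\<bar>) + exp (4 * \<bar>b\<bar>)" for a b :: real
    proof -
      have "\<bar>a\<bar> \<le> exp \<bar>a\<bar>" using exp_ge_add_one_self[of "\<bar>a\<bar>"] by linarith
      then have "\<bar>a\<bar> * exp (2 * \<bar>b\<bar>) \<le> exp \<bar>a\<bar> * exp (2 * \<bar>b\<bar>)" by (rule mult_right_mono) simp
      also have "\<dots> \<le> (exp \<bar>a\<bar>)\<^sup>2 + (exp (2 * \<bar>b\<bar>))\<^sup>2"
      proof -
        have "0 \<le> exp \<bar>a\<bar> * exp (2 * \<bar>b\<bar>)" by simp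
        then show ?thesis using sum_squares_bound[of "exp \<bar>a\<bar>" "exp (2 * \<bar>b\<bar>)"] by linarith
      qed
      finally show ?thesis by (simp add: exp_double[symmetric] mult.assoc[symmetric])
    qed
    from mult_left_mono[OF this, of "\<bar>F x\<bar>" for x]
    have "\<bar>F x\<bar> * (\<bar>lin_form I d x\<bar> * exp (2 * \<bar>lin_form I c x\<bar>)) \<le> \<bar>F x\<bar> * (exp (2 * \<bar>lin_form I d x\<bar>) + exp (4 * \<bar>lin_form I c x\<bar>))" for x
      by simp
    then show "AE x in gauss I. norm (F x * lin_form I d x * exp (2 * \<bar>lin_form I c x\<bar>))
       \<le> norm (\<bar>F x * exp (2 * \<bar>lin_form I d x\<bar>)\<bar> + \<bar>F x * exp (4 * \<bar>lin_form I c x\<bar>)\<bar>)"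
      by (intro AE_I2) (simp add: abs_mult mult.assoc distrib_left)
  qed auto
  show "integrable (gauss I) (\<lambda>x. F x * lin_form I d x * lin_form I c x)"
    by (rule translate_derivative_limit(2)[OF I _ int inverse_Suc_null_sequence]) auto
  have z: "(\<integral>x. (F (translate I c h x) * lin_form I d (translate I c h x) - F x * lin_form I d x) / h \<partial>gauss I)
      = (\<Sum>i\<in>I. d i * c i) * (\<integral>x. F x \<partial>gauss I)" if "h \<noteq> 0" for h
  proof -
    have "(\<integral>x. (F (translate I c h x) * lin_form I d (translate I c h x) - F x * lin_form I d x) / h \<partial>gauss I)
        = (\<integral>x. (\<Sum>i\<in>I. d i * c i) * F x \<partial>gauss I)"
    proof (intro Bochner_Integration.integral_cong refl)
      fix x assume "x \<in> space (gauss I)"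
      then show "(F (translate I c h x) * lin_form I d (translate I c h x) - F x * lin_form I d x) / h = (\<Sum>i\<in>I. d i * c i) * F x"
        using that by (simp add: invariantD[OF inv(1)] lin_form_translate distrib_left)
    qed
    then show ?thesis by simp
  qed
  show "(\<integral>x. F x * lin_form I d x * lin_form I c x \<partial>gauss I) = (\<Sum>i\<in>I. d i * c i) * (\<integral>x. F x \<partial>gauss I)"
  proof (rule gaussian_ibp[OF I _ int])
    show "(\<lambda>k. \<integral>x. (F (translate I c (inverse (real (Suc k))) x) * lin_form I d (translate I c (inverse (real (Suc k))) x) - F x * lin_form I d x) / inverse (real (Suc k)) \<partial>gauss I)
        \<longlonglongrightarrow> (\<Sum>i\<in>I. d i * c i) * (\<integral>x. F x \<partial>gauss I)"
      by (subst z) (simp_all del: of_nat_Suc)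
  qed auto
qed

text \<open>By the mean value theorem on the line through \<open>x\<close>, the difference quotients
  of \<open>F\<close> are values of \<open>G\<close>, hence bounded by \<open>B'\<close>, so that
  the limit may be taken under the integral.\<close>

lemma stein:
  fixes F G :: "('i \<Rightarrow> real) \<Rightarrow> real"
  assumes I: "finite I" and F [measurable]: "F \<in> borel_measurable (gauss I)"
    and G [measurable]: "G \<in> borel_measurable (gauss I)"
    and bF: "\<And>x. x \<in> space (gauss I) \<Longrightarrow> \<bar>F x\<bar> \<le> B"
    and bG: "\<And>x. x \<in> space (gauss I) \<Longrightarrow> \<bar>G x\<bar> \<le> B'"
    and der: "\<And>x h. x \<in> space (gauss I) \<Longrightarrow>
      ((\<lambda>h. F (translate I c h x)) has_real_derivative G (translate I c h x)) (at h)"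
  shows "integrable (gauss I) (\<lambda>x. F x * lin_form I c x)"
    "(\<integral>x. F x * lin_form I c x \<partial>gauss I) = (\<integral>x. G x \<partial>gauss I)"
proof -
  interpret prob_space "gauss I" by (rule prob_space_gauss)
  have "integrable (gauss I) (\<lambda>x. 1 * exp (2 * \<bar>lin_form I c x\<bar>))"
    by (rule integrable_exp_abs_lin_form[OF I]) (auto simp: invariant_def)
  then have e: "integrable (gauss I) (\<lambda>x. B * exp (2 * \<bar>lin_form I c x\<bar>))" by simp
  have int: "integrable (gauss I) (\<lambda>x. F x * exp (2 * \<bar>lin_form I c x\<bar>))"
    by (rule Bochner_Integration.integrable_bound[OF e])
      (auto simp: abs_mult intro!: mult_right_mono AE_I2 order.trans[OF bF abs_ge_self])
  show "integrable (gauss I) (\<lambda>x. F x * lin_form I c x)"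
    by (rule translate_derivative_limit(2)[OF I F int inverse_Suc_null_sequence])
  have "(\<lambda>k. \<integral>x. (F (translate I c (inverse (real (Suc k))) x) - F x) / inverse (real (Suc k)) \<partial>gauss I) \<longlonglongrightarrow> (\<integral>x. G x \<partial>gauss I)"
  proof (rule integral_dominated_convergence[where w = "\<lambda>_. B'"])
    show "AE x in gauss I. (\<lambda>k. (F (translate I c (inverse (real (Suc k))) x) - F x) / inverse (real (Suc k))) \<longlonglongrightarrow> G x"
    proof (rule AE_I2)
      fix x assume x: "x \<in> space (gauss I)"
      have "(\<lambda>t. (F (translate I c t x) - F x) / t) \<midarrow>0\<rightarrow> G x"
        using der[OF x, of 0] x by (simp add: has_field_derivative_iff translate_zero)
      moreover have "filterlim (\<lambda>k. inverse (real (Suc k))) (at 0) sequentially"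
        using inverse_Suc_null_sequence by (intro filterlim_atI) (auto intro!: always_eventually)
      ultimately show "(\<lambda>k. (F (translate I c (inverse (real (Suc k))) x) - F x) / inverse (real (Suc k))) \<longlonglongrightarrow> G x"
        by (rule filterlim_compose)
    qed
    fix k
    show "AE x in gauss I. norm ((F (translate I c (inverse (real (Suc k))) x) - F x) / inverse (real (Suc k))) \<le> B'"
    proof (rule AE_I2)
      fix x assume x: "x \<in> space (gauss I)"
      let ?h = "inverse (real (Suc k))"
      have "\<exists>z. 0 < z \<and> z < ?h \<and> F (translate I c ?h x) - F (translate I c 0 x) = (?h - 0) * G (translate I c z x)"
        by (rule MVT2) (use der[OF x] inverse_Suc_null_sequence(1) in auto)
      then obtain z where "F (translate I c ?h x) - F x = ?h * G (translate I c z x)"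
        using x by (auto simp: translate_zero)
      then show "norm ((F (translate I c ?h x) - F x) / ?h) \<le> B'"
        using bG[OF translate_in_space] by simp
    qed
  qed auto
  then show "(\<integral>x. F x * lin_form I c x \<partial>gauss I) = (\<integral>x. G x \<partial>gauss I)"
    by (rule gaussian_ibp[OF I F int])
qed

text \<open>The translates of \<open>B\<close> by distinct multiples of \<open>c\<close> are disjoint, so their measures tend to 0; by
  Cameron--Martin the measures of small translates also tend to that of \<open>B\<close>.\<close>

lemma null_transversal:
  assumes I: "finite I" and B [measurable]: "B \<in> sets (gauss I)"
    and once: "\<And>x h. x \<in> B \<Longrightarrow> h \<noteq> 0 \<Longrightarrow> translate I c h x \<notin> B"
  shows "emeasure (gauss I) B = 0"
proof -
  interpret prob_space "gauss I" by (rule prob_space_gauss)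
  let ?h = "\<lambda>k. inverse (real (Suc k))"
  let ?F = "indicator B :: _ \<Rightarrow> real"
  let ?S = "\<lambda>k. translate I c (?h k) -` B \<inter> space (gauss I)"
  have S [measurable]: "?S k \<in> sets (gauss I)" for k by measurable
  have "disjoint_family ?S"
    unfolding disjoint_family_on_def
  proof (intro ballI impI)
    fix m k :: nat assume "m \<noteq> k"
    then have ne: "?h k - ?h m \<noteq> 0" by (simp del: of_nat_Suc)
    have "translate I c (?h k) x \<notin> B" if "translate I c (?h m) x \<in> B" for x
      using once[OF that ne] by (simp only: translate_translate diff_add_cancel) simp
    then show "?S m \<inter> ?S k = {}" by blast
  qed
  then have "(\<lambda>k. prob (?S k)) sums prob (\<Union>k. ?S k)"
    using S by (intro finite_measure_UNION) (rule image_subsetI)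
  then have lim0: "(\<lambda>k. prob (?S k)) \<longlonglongrightarrow> 0"
    by (rule summable_LIMSEQ_zero[OF sums_summable])
  have "integrable (gauss I) (\<lambda>x. 1 * exp (2 * \<bar>lin_form I c x\<bar>))"
    by (rule integrable_exp_abs_lin_form[OF I]) (auto simp: invariant_def)
  then have int: "integrable (gauss I) (\<lambda>x. ?F x * exp (2 * \<bar>lin_form I c x\<bar>))"
    by (rule Bochner_Integration.integrable_bound) (auto simp: indicator_def)
  have F [measurable]: "?F \<in> borel_measurable (gauss I)" by measurable
  note L = translate_derivative_limit[OF I F int inverse_Suc_null_sequence]
  \<comment> \<open>The quotients converge even for an indicator; multiplied by the step they show
    that the increments of the measure tend to 0.\<close>
  have "(\<lambda>k. ?h k * (\<integral>x. (?F (translate I c (?h k) x) - ?F x) / ?h k \<partial>gauss I)) \<longlonglongrightarrow> 0 * (\<integral>x. ?F x * lin_form I c x \<partial>gauss I)"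
    by (intro tendsto_mult L(4) inverse_Suc_null_sequence)
  moreover have "?h k * (\<integral>x. (?F (translate I c (?h k) x) - ?F x) / ?h k \<partial>gauss I) = prob (?S k) - prob B" for k
  proof -
    have "?h k * (\<integral>x. (?F (translate I c (?h k) x) - ?F x) / ?h k \<partial>gauss I)
        = (\<integral>x. ?F (translate I c (?h k) x) \<partial>gauss I) - (\<integral>x. ?F x \<partial>gauss I)"
      using L(1) L(3)[of k] inverse_Suc_null_sequence(1)[of k] by (simp del: of_nat_Suc)
    also have "(\<integral>x. ?F (translate I c (?h k) x) \<partial>gauss I) = (\<integral>x. indicator (?S k) x \<partial>gauss I)"
      by (intro Bochner_Integration.integral_cong) (auto simp: indicator_def)
    finally show ?thesis by simp
  qed
  ultimately have "(\<lambda>k. prob (?S k) - prob B) \<longlonglongrightarrow> 0" by (simp only: mult_zero_left)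
  from tendsto_diff[OF lim0 this] have "prob B = 0"
    by (simp add: LIMSEQ_const_iff)
  then show ?thesis by (simp add: emeasure_eq_measure)
qed

section \<open>Gram--Schmidt projections and least squares\<close>

text \<open>Vectors are functions of which only the values below \<open>n\<close> count. This keeps
  carrier conditions out of the projections; matrices appear only where \<open>ols_coef\<close> and
  \<open>partial_cov\<close> force them.\<close>

definition dotn :: "nat \<Rightarrow> (nat \<Rightarrow> real) \<Rightarrow> (nat \<Rightarrow> real) \<Rightarrow> real" where
  "dotn n f g = (\<Sum>t<n. f t * g t)"

definition matapp :: "nat \<Rightarrow> (nat \<Rightarrow> nat \<Rightarrow> real) \<Rightarrow> (nat \<Rightarrow> real) \<Rightarrow> nat \<Rightarrow> real" where
  "matapp n P f s = (\<Sum>t<n. P s t * f t)"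

text \<open>If the residual of a column vanishes, the division by 0 leaves the projection unchanged. Hence
  \<open>gsproj\<close> is always an orthogonal projection; only its trace depends on \<open>gs_ok\<close>.\<close>

fun gsproj :: "nat \<Rightarrow> (nat \<Rightarrow> real) list \<Rightarrow> nat \<Rightarrow> nat \<Rightarrow> real" where
  "gsproj n [] s t = (if s = t then 1 else 0)"
| "gsproj n (f # fs) s t = gsproj n fs s t -
     matapp n (gsproj n fs) f s * matapp n (gsproj n fs) f t /
     dotn n (matapp n (gsproj n fs) f) (matapp n (gsproj n fs) f)"

abbreviation gsres :: "nat \<Rightarrow> (nat \<Rightarrow> real) list \<Rightarrow> (nat \<Rightarrow> real) \<Rightarrow> nat \<Rightarrow> real" where
  "gsres n fs f \<equiv> matapp n (gsproj n fs) f"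

text \<open>Linear independence of the columns as Gram-Schmidt sees it, the last column of the list
  being treated first.\<close>

fun gs_ok :: "nat \<Rightarrow> (nat \<Rightarrow> real) list \<Rightarrow> bool" where
  "gs_ok n [] = True"
| "gs_ok n (f # fs) = (gs_ok n fs \<and> dotn n (gsres n fs f) (gsres n fs f) \<noteq> 0)"

lemma dotn_commute: "dotn n f g = dotn n g f"
  by (simp add: dotn_def mult.commute)

lemma dotn_cong: "(\<And>t. t < n \<Longrightarrow> f t = f' t) \<Longrightarrow> (\<And>t. t < n \<Longrightarrow> g t = g' t) \<Longrightarrow> dotn n f g = dotn n f' g'"
  by (simp add: dotn_def)

lemma dotn_self_nonneg: "0 \<le> dotn n f f"
  by (simp add: dotn_def sum_nonneg)

lemma dotn_self_eq_0: "dotn n f f = 0 \<longleftrightarrow> (\<forall>t<n. f t = 0)"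
  by (auto simp: dotn_def sum_nonneg_eq_0_iff)

lemma dotn_diff_scale: "dotn n f (\<lambda>t. g t - h t * c) = dotn n f g - dotn n f h * c"
  by (simp add: dotn_def algebra_simps sum_subtractf sum_distrib_left)

lemma dotn_sum_right: "dotn n f (\<lambda>t. \<Sum>j\<in>J. w j * g j t) = (\<Sum>j\<in>J. w j * dotn n f (g j))"
  by (simp add: dotn_def sum_distrib_left sum_distrib_right algebra_simps)
     (rule sum.swap)

lemma matapp_cong: "(\<And>t. t < n \<Longrightarrow> f t = g t) \<Longrightarrow> matapp n P f s = matapp n P g s"
  by (simp add: matapp_def)

lemma matapp_diff_scale: "matapp n P (\<lambda>t. g t - h t * c) s = matapp n P g s - matapp n P h s * c"
  by (simp add: matapp_def algebra_simps sum_subtractf sum_distrib_left)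

lemma matapp_sum: "matapp n P (\<lambda>t. \<Sum>j\<in>J. w j * g j t) s = (\<Sum>j\<in>J. w j * matapp n P (g j) s)"
  by (simp add: matapp_def sum_distrib_left sum_distrib_right algebra_simps)
     (rule sum.swap)

lemma matapp_zero: "matapp n P (\<lambda>t. 0) s = 0"
  by (simp add: matapp_def)

lemma gsproj_sym: "gsproj n fs s t = gsproj n fs t s"
  by (induction fs arbitrary: s t) (simp_all add: mult.commute)

lemma gsproj_self_adjoint: "dotn n (gsres n fs f) g = dotn n f (gsres n fs g)"
proof -
  have "dotn n (gsres n fs f) g = (\<Sum>s<n. \<Sum>t<n. gsproj n fs s t * f t * g s)"
    by (simp add: dotn_def matapp_def sum_distrib_right)
  also have "\<dots> = (\<Sum>t<n. \<Sum>s<n. gsproj n fs s t * f t * g s)" by (rule sum.swap)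
  also have "\<dots> = dotn n f (gsres n fs g)"
    by (simp add: dotn_def matapp_def sum_distrib_left gsproj_sym[of n fs _ t for t] mult_ac)
  finally show ?thesis .
qed

lemma gsres_Nil: "s < n \<Longrightarrow> gsres n [] g s = g s"
  by (simp add: matapp_def if_distrib[of "\<lambda>x. x * _"] cong: if_cong)

lemma gsres_Cons:
  "gsres n (f # fs) g s = gsres n fs g s -
     gsres n fs f s * (dotn n (gsres n fs f) g / dotn n (gsres n fs f) (gsres n fs f))"
  by (simp add: matapp_def[of n "gsproj n (f # fs)"] left_diff_distrib sum_subtractf)
     (simp add: matapp_def[of n "gsproj n fs" g] dotn_def[of n _ g] sum_distrib_left sum_divide_distrib mult_ac)

lemma gsproj_idem: "s < n \<Longrightarrow> gsres n fs (gsres n fs g) s = gsres n fs g s"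
proof (induction fs arbitrary: g s)
  case Nil
  then show ?case by (simp only: gsres_Nil)
next
  case (Cons f fs)
  define r where "r = gsres n fs f"
  define c where "c = dotn n r g / dotn n r r"
  have e: "gsres n (f # fs) g' = (\<lambda>t. gsres n fs g' t - r t * (dotn n r g' / dotn n r r))" for g'
    by (rule ext) (simp only: gsres_Cons r_def)
  have r: "gsres n fs r t = r t" if "t < n" for t
    using Cons.IH[OF that] by (simp add: r_def)
  have 1: "gsres n fs (gsres n (f # fs) g) s = gsres n fs g s - r s * c"
    unfolding e c_def[symmetric] by (simp add: matapp_diff_scale Cons r)
  have "dotn n r (gsres n fs g) = dotn n (gsres n fs r) g" by (rule gsproj_self_adjoint[symmetric])
  also have "\<dots> = dotn n r g" by (rule dotn_cong) (simp_all add: r)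
  finally have 2: "dotn n r (gsres n (f # fs) g) = dotn n r g - dotn n r r * c"
    unfolding e c_def[symmetric] by (simp add: dotn_diff_scale)
  \<comment> \<open>For <r, r> = 0 the quotient is 0 by the convention on division; otherwise the
    choice of \<open>c\<close> makes its numerator vanish.\<close>
  have 3: "r s * (dotn n r (gsres n (f # fs) g) / dotn n r r) = 0"
    unfolding 2 by (simp add: c_def)
  have "gsres n (f # fs) (gsres n (f # fs) g) s
      = gsres n fs (gsres n (f # fs) g) s - r s * (dotn n r (gsres n (f # fs) g) / dotn n r r)"
    by (simp only: gsres_Cons r_def)
  also have "\<dots> = gsres n fs g s - r s * c" unfolding 1 3 by simp
  also have "\<dots> = gsres n (f # fs) g s" by (simp only: e c_def)
  finally show ?case .
qed

lemma dotn_gsres_gsres: "dotn n (gsres n fs f) (gsres n fs g) = dotn n f (gsres n fs g)"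
proof -
  have "dotn n (gsres n fs f) (gsres n fs g) = dotn n f (gsres n fs (gsres n fs g))"
    by (rule gsproj_self_adjoint)
  also have "\<dots> = dotn n f (gsres n fs g)"
    by (rule dotn_cong) (simp_all add: gsproj_idem)
  finally show ?thesis .
qed

lemma gsres_kills: "f \<in> set fs \<Longrightarrow> s < n \<Longrightarrow> gsres n fs f s = 0"
proof (induction fs arbitrary: s)
  case (Cons g fs)
  show ?case
  proof (cases "f \<in> set fs")
    case True
    have "dotn n (gsres n fs g) f = dotn n g (gsres n fs f)" by (rule gsproj_self_adjoint)
    also have "\<dots> = 0" using Cons.IH[OF True] by (simp add: dotn_def)
    finally show ?thesis using Cons.IH[OF True] Cons.prems unfolding gsres_Cons by simp
  next
    case False
    then have f: "f = g" using Cons.prems by simp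
    have "dotn n (gsres n fs g) g = dotn n (gsres n fs g) (gsres n fs g)"
      using dotn_gsres_gsres[of n fs g g] by (simp add: dotn_commute)
    \<comment> \<open>The quotient subtracted is 1, unless <r, r> = 0; in that case the residual is
      already 0 below \<open>n\<close>.\<close>
    then show ?thesis
      unfolding f gsres_Cons using Cons.prems dotn_self_eq_0[of n "gsres n fs g"] by auto
  qed
qed simp

lemma gsres_orthogonal: "(\<And>f. f \<in> set fs \<Longrightarrow> dotn n f e = 0) \<Longrightarrow> s < n \<Longrightarrow> gsres n fs e s = e s"
proof (induction fs arbitrary: s)
  case Nil
  then show ?case by (simp only: gsres_Nil)
next
  case (Cons f fs)
  have "dotn n (gsres n fs f) e = dotn n f (gsres n fs e)" by (rule gsproj_self_adjoint)
  also have "\<dots> = dotn n f e" by (rule dotn_cong) (simp_all add: Cons)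
  also have "\<dots> = 0" by (simp add: Cons)
  finally show ?case unfolding gsres_Cons by (simp add: Cons)
qed

text \<open>Each column lowers the trace by <r, r> / <r, r>, which is 1 precisely when its residual
  r is nonzero.\<close>

lemma gsproj_trace: "gs_ok n fs \<Longrightarrow> (\<Sum>t<n. gsproj n fs t t) = real n - real (length fs)"
proof (induction fs)
  case (Cons f fs)
  then have "dotn n (gsres n fs f) (gsres n fs f) \<noteq> 0" by simp
  then have "(\<Sum>t<n. gsres n fs f t * gsres n fs f t / dotn n (gsres n fs f) (gsres n fs f)) = 1"
    by (simp add: sum_divide_distrib[symmetric] dotn_def[symmetric])
  then show ?case using Cons by (simp add: sum_subtractf)
qed simp

lemma gsproj_column:
  assumes "u < n" "s < n"
  shows "gsres n fs (\<lambda>t. gsproj n fs t u) s = gsproj n fs s u"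
proof -
  have e: "gsres n fs (\<lambda>t. if t = u then 1 else 0) s = gsproj n fs s u" for s
    using assms(1) by (simp add: matapp_def if_distrib[of "\<lambda>x. _ * x"] cong: if_cong)
  have "gsres n fs (gsres n fs (\<lambda>t. if t = u then 1 else 0)) s = gsres n fs (\<lambda>t. if t = u then 1 else 0) s"
    using assms(2) by (rule gsproj_idem)
  then show ?thesis by (simp add: e[abs_def])
qed

text \<open>For a symmetric idempotent P, the square of P_tt is one term of the sum giving (P P)_tt
  = P_tt, and p^2 <= p confines p to the unit interval.\<close>

lemma gsproj_diag_le_1: "t < n \<Longrightarrow> \<bar>gsproj n fs t t\<bar> \<le> 1"
proof -
  assume t: "t < n"
  let ?p = "gsproj n fs t t"
  have "?p * ?p \<le> (\<Sum>s<n. gsproj n fs t s * gsproj n fs s t)"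
    using t by (intro member_le_sum[where f = "\<lambda>s. gsproj n fs t s * gsproj n fs s t"])
      (auto simp: gsproj_sym[of n fs t])
  also have "\<dots> = ?p" using gsproj_column[OF t t, of fs] by (simp add: matapp_def)
  finally have "?p * ?p \<le> ?p" .
  then have "0 \<le> ?p"
    using zero_le_square[of ?p] by linarith
  moreover have "\<not> 1 < ?p"
    using \<open>?p * ?p \<le> ?p\<close> mult_strict_right_mono[of 1 ?p ?p] by auto
  ultimately show ?thesis by simp
qed

text \<open>Projecting a vanishing combination off the tail leaves only the term of the head, whose
  residual is nonzero somewhere.\<close>

lemma gs_ok_independent:
  assumes "gs_ok n fs" "\<And>s. s < n \<Longrightarrow> (\<Sum>j<length fs. w j * (fs ! j) s) = 0" "j < length fs"
  shows "w j = 0"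
  using assms
proof (induction fs arbitrary: w j)
  case (Cons f fs)
  have eq: "w 0 * f s + (\<Sum>j<length fs. w (Suc j) * (fs ! j) s) = 0" if "s < n" for s
    using Cons.prems(2)[OF that] by (simp only: length_Cons sum.lessThan_Suc_shift) simp
  have "w 0 * gsres n fs f s = 0" if s: "s < n" for s
  proof -
    have "gsres n fs (\<lambda>s. \<Sum>j<Suc (length fs). w j * ((f # fs) ! j) s) s = gsres n fs (\<lambda>_. 0) s"
      using Cons.prems(2) by (intro matapp_cong) simp
    then have "(\<Sum>j<Suc (length fs). w j * gsres n fs ((f # fs) ! j) s) = 0"
      by (simp only: matapp_sum matapp_zero)
    then have "w 0 * gsres n fs f s + (\<Sum>j<length fs. w (Suc j) * gsres n fs (fs ! j) s) = 0"
      by (simp only: sum.lessThan_Suc_shift) simp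
    moreover have "(\<Sum>j<length fs. w (Suc j) * gsres n fs (fs ! j) s) = 0"
      using gsres_kills[OF _ s] by (intro sum.neutral) auto
    ultimately show ?thesis by simp
  qed
  moreover have "\<exists>s<n. gsres n fs f s \<noteq> 0"
    using Cons.prems(1) dotn_self_eq_0[of n "gsres n fs f"] by auto
  ultimately have w0: "w 0 = 0" by auto
  show ?case
  proof (cases j)
    case 0
    then show ?thesis using w0 by simp
  next
    case (Suc i)
    have "w (Suc i) = 0"
      by (rule Cons.IH[of "\<lambda>j. w (Suc j)"]) (use Cons.prems eq w0 Suc in auto)
    then show ?thesis using Suc by simp
  qed
qed simp

section \<open>Inverse matrices and the normal equations\<close>

lemma
  assumes A: "A \<in> carrier_mat n n" and d: "det A \<noteq> 0"
  shows minv_carrier: "minv A \<in> carrier_mat n n"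
    and mult_minv: "A * minv A = 1\<^sub>m n"
  using adj_mat[OF A] d mult_smult_distrib[OF A adj_mat(1)[OF A], of "1 / det A"]
  by (auto simp: minv_def)

lemma mult_minv_vec:
  assumes A: "A \<in> carrier_mat n n" and d: "det A \<noteq> 0" and v: "v \<in> carrier_vec n"
  shows "A *\<^sub>v (minv A *\<^sub>v v) = v"
  using assoc_mult_mat_vec[OF A minv_carrier[OF A d] v] mult_minv[OF A d] v by simp

lemma index_mult_mat_vec_sum:
  assumes "A \<in> carrier_mat n m" "v \<in> carrier_vec m" "i < n"
  shows "vec_index (A *\<^sub>v v) i = (\<Sum>j<m. A $$ (i, j) * vec_index v j)"
  using assms by (auto simp: scalar_prod_def lessThan_atLeast0 intro!: sum.cong)

text \<open>The Gram matrix is nonsingular: if v is in its kernel, then u = D v satisfies <u, u> =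
  0, so u = 0 and independence gives v = 0. Hence \<open>minv\<close> is a true inverse and
  \<open>b\<close> solves the normal equations, which say that the fitted residual is orthogonal to
  every column.\<close>

lemma normal_equations:
  fixes g :: "nat \<Rightarrow> nat \<Rightarrow> real" and y :: "nat \<Rightarrow> real"
  assumes indep: "\<And>w c. (\<And>t. t < n \<Longrightarrow> (\<Sum>c<m. w c * g c t) = 0) \<Longrightarrow> c < m \<Longrightarrow> w c = 0"
    and c: "c < m"
  defines "D \<equiv> mat n m (\<lambda>(t, c). g c t)"
  defines "b \<equiv> minv (transpose_mat D * D) *\<^sub>v (transpose_mat D *\<^sub>v vec n y)"
  shows "dotn n (g c) (\<lambda>t. y t - (\<Sum>c<m. vec_index b c * g c t)) = 0"
proof -
  have D: "D \<in> carrier_mat n m" by (simp add: D_def)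
  have DT: "transpose_mat D \<in> carrier_mat m n" using D by simp
  have Dv: "vec_index (D *\<^sub>v v) t = (\<Sum>c<m. vec_index v c * g c t)" if "v \<in> carrier_vec m" "t < n" for v t
    unfolding index_mult_mat_vec_sum[OF D that] using that by (intro sum.cong) (simp_all add: D_def)
  have DTv: "vec_index (transpose_mat D *\<^sub>v v) c = (\<Sum>t<n. g c t * vec_index v t)" if "v \<in> carrier_vec n" "c < m" for v c
    unfolding index_mult_mat_vec_sum[OF DT that] using that by (intro sum.cong) (simp_all add: D_def)
  have G: "transpose_mat D * D \<in> carrier_mat m m" using D by simp
  have Gv: "(transpose_mat D * D) *\<^sub>v v = transpose_mat D *\<^sub>v (D *\<^sub>v v)" if "v \<in> carrier_vec m" for v
    by (rule assoc_mult_mat_vec[OF DT D that])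
  have det: "det (transpose_mat D * D) \<noteq> 0"
  proof
    assume "det (transpose_mat D * D) = 0"
    then obtain v where v: "v \<in> carrier_vec m" "v \<noteq> 0\<^sub>v m" "(transpose_mat D * D) *\<^sub>v v = 0\<^sub>v m"
      using det_0_iff_vec_prod_zero[OF G] by auto
    define u where "u = (\<lambda>t. \<Sum>c<m. vec_index v c * g c t)"
    have Dvc: "D *\<^sub>v v \<in> carrier_vec n" using D v by simp
    have ug: "dotn n u (g c) = 0" if "c < m" for c
    proof -
      have "dotn n u (g c) = dotn n (g c) u" by (rule dotn_commute)
      also have "dotn n (g c) u = vec_index (transpose_mat D *\<^sub>v (D *\<^sub>v v)) c"
        unfolding DTv[OF Dvc that] dotn_def u_def by (intro sum.cong refl) (simp only: Dv[OF v(1)] lessThan_iff)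
      also have "\<dots> = 0" using v(3) that unfolding Gv[OF v(1)] by simp
      finally show ?thesis .
    qed
    have "dotn n u u = (\<Sum>c<m. vec_index v c * dotn n u (g c))"
      by (subst (2) u_def) (rule dotn_sum_right)
    also have "\<dots> = 0" by (simp add: ug)
    finally have "dotn n u u = 0" .
    then have "\<And>t. t < n \<Longrightarrow> u t = 0" by (simp add: dotn_self_eq_0)
    then have "vec_index v c = 0" if "c < m" for c
      using indep[of "vec_index v" c] that by (simp add: u_def)
    then have "v = 0\<^sub>v m" using v(1) by (intro eq_vecI) auto
    with v(2) show False by simp
  qed
  have yc: "transpose_mat D *\<^sub>v vec n y \<in> carrier_vec m" using DT by simp
  have b: "b \<in> carrier_vec m" unfolding b_def using minv_carrier[OF G det] yc by simp
  have "transpose_mat D *\<^sub>v (D *\<^sub>v b) = transpose_mat D *\<^sub>v vec n y"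
    unfolding Gv[OF b, symmetric] unfolding b_def by (rule mult_minv_vec[OF G det yc])
  then have "vec_index (transpose_mat D *\<^sub>v (D *\<^sub>v b)) c = vec_index (transpose_mat D *\<^sub>v vec n y) c"
    by simp
  moreover have Db: "D *\<^sub>v b \<in> carrier_vec n" using D b by simp
  have "vec_index (transpose_mat D *\<^sub>v (D *\<^sub>v b)) c = (\<Sum>t<n. g c t * (\<Sum>c<m. vec_index b c * g c t))"
    unfolding DTv[OF Db c] by (intro sum.cong refl) (simp only: Dv[OF b] lessThan_iff)
  moreover have "vec_index (transpose_mat D *\<^sub>v vec n y) c = (\<Sum>t<n. g c t * y t)"
    using c by (simp add: DTv del: index_mult_mat_vec)
  ultimately have "(\<Sum>t<n. g c t * (\<Sum>c<m. vec_index b c * g c t)) = (\<Sum>t<n. g c t * y t)" by simp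
  then show ?thesis by (simp add: dotn_def right_diff_distrib sum_subtractf)
qed

text \<open>The Frisch-Waugh-Lovell theorem. Let r be the residual of A after the other columns and
  e the fitted residual. Then <r, e> = 0, since e is orthogonal to all columns. Pairing y with r
  kills the other columns and leaves <r, y> = b_1 <r, r>.\<close>

lemma ols_coef_eq:
  fixes x :: "nat \<Rightarrow> 'v::linorder \<Rightarrow> real"
  defines "fs K \<equiv> map (\<lambda>k t. x t k) (sorted_list_of_set K) @ [\<lambda>_. 1]"
  assumes ok: "gs_ok n ((\<lambda>t. x t A) # fs K)"
  shows "ols_coef n x A Y K = dotn n (gsres n (fs K) (\<lambda>t. x t A)) (\<lambda>t. x t Y) /
     dotn n (gsres n (fs K) (\<lambda>t. x t A)) (gsres n (fs K) (\<lambda>t. x t A))"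
proof -
  define ks where "ks = sorted_list_of_set K"
  define p where "p = length ks"
  define a where "a = (\<lambda>t. x t A)"
  define y where "y = (\<lambda>t. x t Y)"
  define F where "F = map (\<lambda>k t. x t k) ks @ [\<lambda>_. 1]"
  have F: "fs K = F" by (simp add: F_def fs_def ks_def)
  define g where "g c t = (if c = 0 then 1 else if c = 1 then a t else x t (ks ! (c - 2)))" for c t
  define r where "r = gsres n F a"
  have sum_split: "(\<Sum>c<p + 2. h c) = h 0 + h 1 + (\<Sum>j<p. h (j + 2))" for h :: "nat \<Rightarrow> real"
    unfolding add_2_eq_Suc' sum.lessThan_Suc_shift by simp
  have okF: "gs_ok n (a # F)" using ok by (simp add: F a_def)
  have indep: "w c = 0" if w: "\<And>t. t < n \<Longrightarrow> (\<Sum>c<p + 2. w c * g c t) = 0" and c: "c < p + 2" for w c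
  proof -
    \<comment> \<open>\<open>D\<close> lists the intercept, A and the covariates in this order,
      whereas \<open>a # F\<close> has A first and the intercept last; \<open>w'\<close> permutes
      the coefficients accordingly.\<close>
    define w' where "w' j = (if j = 0 then w 1 else if j = Suc p then w 0 else w (j + 1))" for j
    have len: "length (a # F) = Suc (Suc p)" by (simp add: F_def p_def)
    have "(\<Sum>j<length (a # F). w' j * ((a # F) ! j) t) = 0" if t: "t < n" for t
    proof -
      have "(\<Sum>j<length (a # F). w' j * ((a # F) ! j) t)
          = w 1 * a t + ((\<Sum>j<p. w' (Suc j) * (F ! j) t) + w' (Suc p) * (F ! p) t)"
        unfolding len sum.lessThan_Suc_shift[of _ "Suc p"] by (simp add: w'_def)
      also have "(\<Sum>j<p. w' (Suc j) * (F ! j) t) = (\<Sum>j<p. w (j + 2) * g (j + 2) t)"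
        by (intro sum.cong) (auto simp: w'_def g_def F_def nth_append p_def)
      also have "w' (Suc p) * (F ! p) t = w 0" by (simp add: w'_def F_def nth_append p_def)
      finally show ?thesis
        using w[OF t] unfolding sum_split by (simp add: g_def)
    qed
    from gs_ok_independent[OF okF this] have w'0: "w' j = 0" if "j < Suc (Suc p)" for j
      using that len by simp
    consider "c = 0" | "c = 1" | i where "c = i + 2" "i < p"
      using c by (metis One_nat_def add_2_eq_Suc' add_less_cancel_right less_2_cases_iff not0_implies_Suc)
    then show ?thesis
    proof cases
      case 1
      then show ?thesis using w'0[of "Suc p"] by (simp add: w'_def)
    next
      case 2
      then show ?thesis using w'0[of 0] by (simp add: w'_def)
    next
      case (3 i)
      then show ?thesis using w'0[of "Suc i"] by (simp add: w'_def)
    qed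
  qed
  define D where "D = mat n (p + 2) (\<lambda>(t, c). g c t)"
  define b where "b = minv (transpose_mat D * D) *\<^sub>v (transpose_mat D *\<^sub>v vec n y)"
  define e where "e = (\<lambda>t. y t - (\<Sum>c<p + 2. vec_index b c * g c t))"
  have ne: "dotn n (g c) e = 0" if "c < p + 2" for c
    unfolding e_def b_def D_def
  proof (rule normal_equations)
    fix w c assume "\<And>t. t < n \<Longrightarrow> (\<Sum>c<p + 2. w c * g c t) = 0" "c < p + 2"
    then show "w c = 0" by (rule indep)
  qed (rule that)
  have g0: "g 0 = (\<lambda>_. 1)" and g1: "g 1 = a" by (simp_all add: g_def fun_eq_iff)
  have g2: "g (j + 2) = (\<lambda>t. x t (ks ! j))" for j by (simp add: g_def fun_eq_iff)
  have F_g: "\<exists>c<p + 2. f = g c" if "f \<in> set F" for f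
  proof -
    have "f = (\<lambda>_. 1) \<or> (\<exists>k\<in>set ks. f = (\<lambda>t. x t k))" using that by (auto simp: F_def)
    then consider "f = g 0" | j where "j < p" "f = g (j + 2)"
      unfolding g0 g2 p_def by (auto simp only: in_set_conv_nth)
    then show ?thesis
      by cases (use add_less_mono1 in \<open>auto intro: exI[of _ 0] exI[of _ "j + 2" for j]\<close>)
  qed
  have "dotn n r e = dotn n a (gsres n F e)" unfolding r_def by (rule gsproj_self_adjoint)
  also have "\<dots> = dotn n a e"
    using F_g ne by (intro dotn_cong gsres_orthogonal) auto
  also have "\<dots> = 0" using ne[of 1] by (simp add: g1[symmetric])
  finally have re: "dotn n r e = 0" .
  have rF: "dotn n r f = 0" if "f \<in> set F" for f
  proof -
    have "dotn n r f = dotn n a (gsres n F f)" unfolding r_def by (rule gsproj_self_adjoint)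
    also have "\<dots> = 0" using gsres_kills[OF that] by (simp add: dotn_def)
    finally show ?thesis .
  qed
  have ra: "dotn n r a = dotn n r r"
    unfolding r_def dotn_gsres_gsres by (rule dotn_commute)
  have "dotn n r (\<lambda>t. \<Sum>c<p + 2. vec_index b c * g c t) = vec_index b 1 * dotn n r r"
    unfolding dotn_sum_right unfolding sum_split
    using rF by (simp add: g0 g1[simplified] g2[simplified] ra F_def p_def)
  moreover have "dotn n r e = dotn n r y - dotn n r (\<lambda>t. \<Sum>c<p + 2. vec_index b c * g c t)"
    unfolding e_def using dotn_diff_scale[of n r y _ 1] by simp
  ultimately have "dotn n r y = vec_index b 1 * dotn n r r" using re by simp
  moreover have "dotn n r r \<noteq> 0" using okF by (simp add: r_def)
  moreover have "ols_coef n x A Y K = vec_index b 1"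
    unfolding ols_coef_def Let_def ks_def[symmetric] p_def[symmetric] b_def D_def g_def a_def y_def by simp
  ultimately show ?thesis
    by (simp add: F a_def[symmetric] y_def[symmetric] r_def[symmetric])
qed

section \<open>The linear structural equation model\<close>

lemma lin_form_diff_left: "lin_form V (\<lambda>i. f i - g i) h = lin_form V f h - lin_form V g h"
  by (simp add: lin_form_def sum_subtractf left_diff_distrib)

lemma lin_form_sum_left: "lin_form V (\<lambda>i. \<Sum>u\<in>T. d u * C u i) h = (\<Sum>u\<in>T. d u * lin_form V (C u) h)"
  by (simp add: lin_form_def sum_distrib_right sum_distrib_left mult.assoc) (rule sum.swap)

lemma lin_form_commute: "lin_form V f g = lin_form V g f"
  by (simp add: lin_form_def mult.commute)

lemma lin_form_self_nonneg: "0 \<le> lin_form V f f"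
  by (simp add: lin_form_def sum_nonneg)

lemma lin_form_self_eq_0: "finite V \<Longrightarrow> lin_form V f f = 0 \<longleftrightarrow> (\<forall>i\<in>V. f i = 0)"
  by (simp add: lin_form_def sum_nonneg_eq_0_iff)

definition lin_indep :: "'v set \<Rightarrow> ('v \<Rightarrow> 'v \<Rightarrow> real) \<Rightarrow> bool" where
  "lin_indep V C \<longleftrightarrow> (\<forall>a. (\<forall>i\<in>V. (\<Sum>v\<in>V. a v * C v i) = 0) \<longrightarrow> (\<forall>v\<in>V. a v = 0))"

lemma lin_indep_subset:
  assumes "finite V" "lin_indep V C" "T \<subseteq> V" "\<And>i. i \<in> V \<Longrightarrow> (\<Sum>v\<in>T. a v * C v i) = 0" "v \<in> T"
  shows "a v = 0"
proof -
  define a' where "a' v = (if v \<in> T then a v else 0)" for v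
  have "(\<Sum>v\<in>V. a' v * C v i) = 0" if "i \<in> V" for i
  proof -
    have "(\<Sum>v\<in>V. a' v * C v i) = (\<Sum>v\<in>T. a v * C v i)"
      using assms(1,3) by (intro sum.mono_neutral_cong_right) (auto simp: a'_def)
    then show ?thesis using assms(4)[OF that] by simp
  qed
  then have "a' v = 0" using assms(2,3,5) unfolding lin_indep_def by blast
  then show ?thesis using assms(5) by (simp add: a'_def)
qed

locale dag_weights =
  fixes V :: "'v set" and E :: "('v \<times> 'v) set" and \<beta> :: "'v \<Rightarrow> 'v \<Rightarrow> real" and \<sigma> :: "'v \<Rightarrow> real"
  assumes dag: "is_dag V E"
begin

lemma finite_V: "finite V" and E_subset: "E \<subseteq> V \<times> V" and acyclic_E: "acyclic E"
  using dag unfolding is_dag_def by blast+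

lemma finite_E: "finite E"
  by (rule finite_subset[OF E_subset finite_cartesian_product[OF finite_V finite_V]])

lemma wf_E: "wf E"
  by (rule finite_acyclic_wf[OF finite_E acyclic_E])

text \<open>\<open>noise_coef v i\<close> is the coefficient of the standardised noise of \<open>i\<close> in the variable \<open>v\<close>.\<close>

definition noise_coef :: "'v \<Rightarrow> 'v \<Rightarrow> real" where
  "noise_coef = wfrec E (\<lambda>f v i. (\<Sum>u\<in>parents E v. \<beta> v u * f u i) + (if i = v then \<sigma> v else 0))"

lemma noise_coef_eq:
  "noise_coef v i = (\<Sum>u\<in>parents E v. \<beta> v u * noise_coef u i) + (if i = v then \<sigma> v else 0)"
proof -
  let ?H = "\<lambda>f v i. (\<Sum>u\<in>parents E v. \<beta> v u * f u i) + (if i = v then \<sigma> v else 0)"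
  have "noise_coef v = ?H (cut noise_coef E v) v"
    unfolding noise_coef_def by (rule wfrec[OF wf_E])
  then have "noise_coef v i = ?H (cut noise_coef E v) v i" by (rule fun_cong)
  also have "\<dots> = ?H noise_coef v i"
    by (intro arg_cong2[of _ _ _ _ "(+)"] sum.cong refl) (simp add: cut_apply parents_def)
  finally show ?thesis .
qed

lemma noise_coef_ancestor: "noise_coef v i \<noteq> 0 \<Longrightarrow> (i, v) \<in> E\<^sup>*"
proof (induction v rule: wf_induct_rule[OF wf_E])
  case (1 v)
  show ?case
  proof (cases "i = v")
    case False
    then have "(\<Sum>u\<in>parents E v. \<beta> v u * noise_coef u i) \<noteq> 0"
      using "1.prems" unfolding noise_coef_eq[of v i] by simp
    then obtain u where "u \<in> parents E v" "noise_coef u i \<noteq> 0"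
      by (elim sum.not_neutral_contains_not_neutral) simp
    then have "(u, v) \<in> E" "(i, u) \<in> E\<^sup>*" using "1.IH"[of u] by (simp_all add: parents_def)
    then show ?thesis by (rule rtrancl_into_rtrancl[rotated])
  qed simp
qed

lemma noise_coef_self: "noise_coef v v = \<sigma> v"
proof -
  have "noise_coef u v = 0" if "u \<in> parents E v" for u
  proof (rule ccontr)
    assume "noise_coef u v \<noteq> 0"
    then have "(v, u) \<in> E\<^sup>*" by (rule noise_coef_ancestor)
    with that have "(v, v) \<in> E\<^sup>+" unfolding parents_def by (simp add: rtrancl_into_trancl1)
    then show False using acyclic_E unfolding acyclic_def by blast
  qed
  then show ?thesis by (subst noise_coef_eq) simp
qed

text \<open>The coefficients are triangular for the ancestor order, with the positive \<sigma> on
  the diagonal. Coordinate \<open>v\<close> of a vanishing combination involves \<open>v\<close> and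
  its descendants only, so the induction proceeds from the sinks upwards.\<close>

lemma lin_indep_noise_coef:
  assumes \<sigma>: "\<And>v. v \<in> V \<Longrightarrow> \<sigma> v > 0"
  shows "lin_indep V noise_coef"
  unfolding lin_indep_def
proof (intro allI impI ballI)
  fix a v assume a: "\<forall>i\<in>V. (\<Sum>v\<in>V. a v * noise_coef v i) = 0" and v: "v \<in> V"
  have "wf ((E\<^sup>+)\<inverse>)"
    using wf_trancl[OF finite_acyclic_wf_converse[OF finite_E acyclic_E]] by (simp add: trancl_converse)
  then show "a v = 0" using v
  proof (induction v rule: wf_induct_rule)
    case (less v)
    have "a u * noise_coef u v = 0" if "u \<in> V" "u \<noteq> v" for u
    proof (cases "noise_coef u v = 0")
      case False
      then have "(v, u) \<in> E\<^sup>+"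
        using noise_coef_ancestor[OF False] that by (auto simp: rtrancl_eq_or_trancl)
      then show ?thesis using less.IH that by simp
    qed simp
    then have "(\<Sum>u\<in>V - {v}. a u * noise_coef u v) = 0" by (intro sum.neutral) blast
    then have "(\<Sum>u\<in>V. a u * noise_coef u v) = a v * noise_coef v v"
      using finite_V less.prems by (simp add: sum.remove[of _ v])
    then show ?case using a less.prems \<sigma>[OF less.prems] by (simp add: noise_coef_self)
  qed
qed

lemma sem_solution:
  assumes \<sigma>: "\<And>v. v \<in> V \<Longrightarrow> \<sigma> v > 0"
    and x: "\<And>v. v \<in> V \<Longrightarrow> x v = (\<Sum>u\<in>parents E v. \<beta> v u * x u) + e v"
    and v: "v \<in> V"
  shows "x v = (\<Sum>i\<in>V. noise_coef v i * (e i / \<sigma> i))"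
  using v
proof (induction v rule: wf_induct_rule[OF wf_E])
  case (1 v)
  have IH: "x u = (\<Sum>i\<in>V. noise_coef u i * (e i / \<sigma> i))" if "u \<in> parents E v" for u
    using "1.IH"[of u] that E_subset by (auto simp: parents_def)
  have "(\<Sum>i\<in>V. noise_coef v i * (e i / \<sigma> i))
      = (\<Sum>i\<in>V. (\<Sum>u\<in>parents E v. \<beta> v u * noise_coef u i) * (e i / \<sigma> i)) + (\<Sum>i\<in>V. (if i = v then \<sigma> v else 0) * (e i / \<sigma> i))"
    by (subst noise_coef_eq) (simp only: distrib_right sum.distrib)
  also have "(\<Sum>i\<in>V. (if i = v then \<sigma> v else 0) * (e i / \<sigma> i)) = e v"
  proof -
    have "(\<Sum>i\<in>V. (if i = v then \<sigma> v else 0) * (e i / \<sigma> i)) = (\<Sum>i\<in>V. if i = v then e v else 0)"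
      using \<sigma>[OF "1.prems"] by (intro sum.cong) auto
    then show ?thesis using finite_V "1.prems" by simp
  qed
  also have "(\<Sum>i\<in>V. (\<Sum>u\<in>parents E v. \<beta> v u * noise_coef u i) * (e i / \<sigma> i))
      = (\<Sum>u\<in>parents E v. \<beta> v u * (\<Sum>i\<in>V. noise_coef u i * (e i / \<sigma> i)))"
    by (simp add: sum_distrib_left sum_distrib_right mult.assoc sum_divide_distrib) (rule sum.swap)
  also have "\<dots> = (\<Sum>u\<in>parents E v. \<beta> v u * x u)" by (simp add: IH)
  finally show ?case using x[OF "1.prems"] by simp
qed

end

text \<open>\<open>Sig\<close> is the Gram matrix of the vectors \<open>C u\<close>. Subtracting
  from \<open>C v\<close> its orthogonal projection onto the span of the \<open>C u\<close> with u
  in \<open>T\<close> leaves a vector whose squared norm is the Schur complement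
  \<open>partial_cov Sig v v T\<close>; linear independence makes it positive. The coefficients
  \<open>d\<close> are the entries of \<open>minv S * s\<close>.\<close>

lemma population_regression:
  fixes C :: "'v::linorder \<Rightarrow> 'v \<Rightarrow> real"
  assumes V: "finite V" and indep: "lin_indep V C"
    and Sig: "\<And>u w. u \<in> V \<Longrightarrow> w \<in> V \<Longrightarrow> Sig u w = lin_form V (C u) (C w)"
    and T: "T \<subseteq> V" and v: "v \<in> V" "v \<notin> T"
  obtains d where "\<And>x. x \<in> T \<Longrightarrow> lin_form V (\<lambda>i. C v i - (\<Sum>u\<in>T. d u * C u i)) (C x) = 0"
    "lin_form V (\<lambda>i. C v i - (\<Sum>u\<in>T. d u * C u i)) (C v) = partial_cov Sig v v T"
    "0 < partial_cov Sig v v T"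
proof -
  define xs where "xs = sorted_list_of_set T"
  define m where "m = length xs"
  have fT: "finite T" using T V finite_subset by blast
  have set_xs: "set xs = T" and dist: "distinct xs" using fT by (auto simp: xs_def)
  have bij: "bij_betw ((!) xs) {..<m} T"
    using bij_betw_nth[OF dist] set_xs by (auto simp: m_def)
  have xV: "xs ! j \<in> V" if "j < m" for j
    using that nth_mem[of j xs] T set_xs unfolding m_def by blast
  have nthT: "\<exists>i<m. u = xs ! i" if "u \<in> T" for u
    using that unfolding set_xs[symmetric] m_def by (auto simp: in_set_conv_nth)
  \<comment> \<open>Matrix entries are indexed by positions in \<open>xs\<close>, regression
    coefficients by variables; \<open>idx\<close> and \<open>sumT\<close> translate between the
    two.\<close>
  define idx where "idx = inv_into {..<m} ((!) xs)"
  have idx: "idx (xs ! j) = j" if "j < m" for j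
    unfolding idx_def by (rule inv_into_f_f[OF bij_betw_imp_inj_on[OF bij]]) (simp add: that)
  have sumT: "(\<Sum>u\<in>T. w (idx u) * f u) = (\<Sum>j<m. w j * f (xs ! j))" for w :: "nat \<Rightarrow> real" and f
    unfolding sum.reindex_bij_betw[OF bij, symmetric] by (intro sum.cong refl) (simp add: idx)
  define S where "S = cov_mat Sig xs xs"
  have S: "S \<in> carrier_mat m m" by (simp add: S_def cov_mat_def m_def)
  have S_index: "S $$ (i, j) = lin_form V (C (xs ! i)) (C (xs ! j))" if "i < m" "j < m" for i j
    using that xV by (simp add: S_def cov_mat_def m_def Sig)
  have det: "det S \<noteq> 0"
  proof
    assume "det S = 0"
    then obtain w where w: "w \<in> carrier_vec m" "w \<noteq> 0\<^sub>v m" "S *\<^sub>v w = 0\<^sub>v m"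
      using det_0_iff_vec_prod_zero[OF S] by auto
    define f where "f = (\<lambda>i. \<Sum>u\<in>T. vec_index w (idx u) * C u i)"
    have Cf: "lin_form V (C u) f = 0" if u: "u \<in> T" for u
    proof -
      obtain i where i: "i < m" "u = xs ! i" using nthT[OF u] by blast
      have "vec_index (S *\<^sub>v w) i = (\<Sum>j<m. S $$ (i, j) * vec_index w j)"
        by (rule index_mult_mat_vec_sum[OF S w(1) i(1)])
      also have "\<dots> = (\<Sum>j<m. vec_index w j * lin_form V (C (xs ! j)) (C u))"
        using i by (intro sum.cong refl) (simp add: S_index lin_form_commute)
      also have "\<dots> = lin_form V f (C u)"
        unfolding f_def lin_form_sum_left sumT[of "vec_index w"] ..
      finally show ?thesis using w(3) i(1) by (simp add: lin_form_commute)
    qed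
    have "lin_form V f f = (\<Sum>u\<in>T. vec_index w (idx u) * lin_form V (C u) f)"
      by (subst f_def) (rule lin_form_sum_left)
    then have "lin_form V f f = 0" by (simp add: Cf)
    then have f0: "\<And>i. i \<in> V \<Longrightarrow> f i = 0" using lin_form_self_eq_0[OF V, of f] by simp
    have wT: "vec_index w (idx u) = 0" if "u \<in> T" for u
      by (rule lin_indep_subset[OF V indep T _ that]) (use f0 in \<open>simp add: f_def\<close>)
    have "vec_index w j = 0" if "j < m" for j
      using wT[of "xs ! j"] idx[OF that] bij_betwE[OF bij] that by simp
    then have "w = 0\<^sub>v m" using w(1) by (intro eq_vecI) auto
    then show False using w(2) by simp
  qed
  define s where "s = cov_mat Sig xs [v]"
  have s: "s \<in> carrier_mat m 1" by (simp add: s_def cov_mat_def m_def)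
  define \<delta> where "\<delta> = minv S * s"
  have \<delta>: "\<delta> \<in> carrier_mat m 1" using minv_carrier[OF S det] s by (simp add: \<delta>_def)
  have "S * \<delta> = s"
    using assoc_mult_mat[OF S minv_carrier[OF S det] s] mult_minv[OF S det] s by (simp add: \<delta>_def)
  have S\<delta>: "(\<Sum>j<m. S $$ (i, j) * \<delta> $$ (j, 0)) = Sig (xs ! i) v" if "i < m" for i
  proof -
    have "Sig (xs ! i) v = s $$ (i, 0)" using that by (simp add: s_def cov_mat_def m_def)
    also have "\<dots> = (S * \<delta>) $$ (i, 0)" by (simp only: \<open>S * \<delta> = s\<close>)
    also have "\<dots> = (\<Sum>j<m. S $$ (i, j) * \<delta> $$ (j, 0))"
      using that S \<delta> by (simp add: scalar_prod_def lessThan_atLeast0)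
    finally show ?thesis ..
  qed
  define d where "d u = \<delta> $$ (idx u, 0)" for u
  define R where "R = (\<lambda>i. C v i - (\<Sum>u\<in>T. d u * C u i))"
  have R_lin_form: "lin_form V R h = lin_form V (C v) h - (\<Sum>j<m. \<delta> $$ (j, 0) * lin_form V (C (xs ! j)) h)" for h
    unfolding R_def lin_form_diff_left lin_form_sum_left d_def sumT[of "\<lambda>j. \<delta> $$ (j, 0)"] ..
  have orth: "lin_form V R (C x) = 0" if x: "x \<in> T" for x
  proof -
    obtain i where i: "i < m" "x = xs ! i" using nthT[OF x] by blast
    have "(\<Sum>j<m. \<delta> $$ (j, 0) * lin_form V (C (xs ! j)) (C x)) = (\<Sum>j<m. S $$ (i, j) * \<delta> $$ (j, 0))"
      using i by (intro sum.cong refl) (simp add: S_index lin_form_commute)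
    also have "\<dots> = Sig x v" using S\<delta> i by simp
    also have "\<dots> = lin_form V (C v) (C x)" using Sig[of x v] x T v by (auto simp: lin_form_commute)
    finally show ?thesis by (simp add: R_lin_form)
  qed
  have "partial_cov Sig v v T = Sig v v - (cov_mat Sig [v] xs * minv S * s) $$ (0, 0)"
    by (simp add: partial_cov_def Let_def xs_def S_def s_def)
  also have "cov_mat Sig [v] xs * minv S * s = cov_mat Sig [v] xs * \<delta>"
  proof -
    have "cov_mat Sig [v] xs \<in> carrier_mat 1 m" by (simp add: cov_mat_def m_def)
    then show ?thesis unfolding \<delta>_def by (rule assoc_mult_mat[OF _ minv_carrier[OF S det] s])
  qed
  also have "\<dots> $$ (0, 0) = (\<Sum>j<m. Sig v (xs ! j) * \<delta> $$ (j, 0))"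
    using \<delta> by (simp add: cov_mat_def m_def scalar_prod_def lessThan_atLeast0)
  also have "\<dots> = (\<Sum>j<m. \<delta> $$ (j, 0) * lin_form V (C (xs ! j)) (C v))"
    using xV v by (intro sum.cong refl) (simp add: Sig lin_form_commute)
  finally have pc: "partial_cov Sig v v T = lin_form V R (C v)"
    using v by (simp add: R_lin_form Sig)
  have RR: "lin_form V R R = lin_form V R (C v)"
  proof -
    have "lin_form V R R = lin_form V (C v) R - (\<Sum>u\<in>T. d u * lin_form V (C u) R)"
      by (subst R_def) (simp only: lin_form_diff_left lin_form_sum_left)
    also have "(\<Sum>u\<in>T. d u * lin_form V (C u) R) = 0"
    proof (intro sum.neutral ballI)
      fix u assume "u \<in> T"
      then have "lin_form V (C u) R = 0" using orth[of u] by (subst lin_form_commute)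
      then show "d u * lin_form V (C u) R = 0" by simp
    qed
    finally show ?thesis by (simp add: lin_form_commute)
  qed
  have "lin_form V R R \<noteq> 0"
  proof
    assume "lin_form V R R = 0"
    then have R0: "\<And>i. i \<in> V \<Longrightarrow> R i = 0" using lin_form_self_eq_0[OF V, of R] by simp
    \<comment> \<open>If \<open>R\<close> vanished, \<open>a\<close> would be a linear relation
      among the \<open>C u\<close> with coefficient 1 at \<open>v\<close>.\<close>
    define a where "a u = (if u = v then 1 else - d u :: real)" for u
    have "(\<Sum>u\<in>insert v T. a u * C u i) = 0" if "i \<in> V" for i
    proof -
      have "(\<Sum>u\<in>T. a u * C u i) = - (\<Sum>u\<in>T. d u * C u i)"
        unfolding sum_negf[symmetric] using v by (intro sum.cong) (auto simp: a_def)
      then show ?thesis using R0[OF that] fT v by (simp add: R_def a_def)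
    qed
    then have "a v = 0"
      using lin_indep_subset[OF V indep, of "insert v T" a v] T v by auto
    then show False by (simp add: a_def)
  qed
  then have "0 < lin_form V R R" using lin_form_self_nonneg[of V R] by simp
  then show thesis
    using that[of d] orth pc RR unfolding R_def by simp
qed

section \<open>Gaussian samples\<close>

text \<open>The columns are a fixed list of functions of \<open>z\<close>, so that the recursion can
  be followed uniformly in \<open>z\<close>. Division of reals is total and measurable, so vanishing
  residuals cause no case split.\<close>

lemma gsproj_measurable:
  assumes "\<And>g t. g \<in> set gs \<Longrightarrow> t < n \<Longrightarrow> (\<lambda>z. g z t) \<in> borel_measurable M"
  shows "(\<lambda>z. gsproj n (map (\<lambda>g. g z) gs) s t) \<in> borel_measurable M"
  using assms
proof (induction gs arbitrary: s t)
  case (Cons g gs)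
  have P [measurable]: "(\<lambda>z. gsproj n (map (\<lambda>g. g z) gs) s t) \<in> borel_measurable M" for s t
    by (rule Cons.IH) (simp add: Cons.prems)
  have r [measurable]: "(\<lambda>z. matapp n (gsproj n (map (\<lambda>g. g z) gs)) (g z) s) \<in> borel_measurable M" for s
    unfolding matapp_def
    by (intro borel_measurable_sum borel_measurable_times P) (simp add: Cons.prems)
  show ?case
    unfolding list.map gsproj.simps dotn_def
    by (intro borel_measurable_diff borel_measurable_divide borel_measurable_times borel_measurable_sum P r)
qed simp

lemma det_measurable:
  assumes "\<And>z. M z \<in> carrier_mat m m"
    and "\<And>i j. i < m \<Longrightarrow> j < m \<Longrightarrow> (\<lambda>z. M z $$ (i, j)) \<in> borel_measurable N"
  shows "(\<lambda>z. det (M z) :: real) \<in> borel_measurable N"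
  unfolding det_def'[OF assms(1)]
  by (intro borel_measurable_sum borel_measurable_times borel_measurable_prod borel_measurable_const assms(2))
     (auto dest: permutes_in_image)

text \<open>By the adjugate formula each entry is a quotient of polynomials in the entries of the
  matrix, measurable also where the determinant is 0.\<close>

lemma minv_measurable:
  assumes M: "\<And>z. M z \<in> carrier_mat m m"
    and "\<And>i j. i < m \<Longrightarrow> j < m \<Longrightarrow> (\<lambda>z. M z $$ (i, j)) \<in> borel_measurable N"
    and ij: "i < m" "j < m"
  shows "(\<lambda>z. minv (M z) $$ (i, j)) \<in> borel_measurable N"
proof -
  have "minv (M z) $$ (i, j) = 1 / det (M z) * ((-1) ^ (j + i) * det (mat_delete (M z) j i))" for z
    using M[of z] ij by (simp add: minv_def adj_mat_def cofactor_def)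
  moreover have "(\<lambda>z. det (mat_delete (M z) j i)) \<in> borel_measurable N"
  proof (rule det_measurable)
    show "mat_delete (M z) j i \<in> carrier_mat (m - 1) (m - 1)" for z
      by (rule mat_delete_carrier[OF M])
    fix i' j' assume "i' < m - 1" "j' < m - 1"
    then have "mat_delete (M z) j i $$ (i', j') = M z $$ (if i' < j then i' else Suc i', if j' < i then j' else Suc j')" for z
      using M[of z] by (simp add: mat_delete_def)
    then show "(\<lambda>z. mat_delete (M z) j i $$ (i', j')) \<in> borel_measurable N"
      using \<open>i' < m - 1\<close> \<open>j' < m - 1\<close> by (simp add: assms(2))
  qed
  moreover have "(\<lambda>z. det (M z)) \<in> borel_measurable N" by (rule det_measurable[OF assms(1,2)])
  ultimately show ?thesis by simp
qed

lemma ols_coef_measurable: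
  fixes x :: "'z \<Rightarrow> nat \<Rightarrow> 'v::linorder \<Rightarrow> real"
  assumes x: "\<And>t v. t < n \<Longrightarrow> (\<lambda>z. x z t v) \<in> borel_measurable N"
  shows "(\<lambda>z. ols_coef n (x z) A Y K) \<in> borel_measurable N"
proof -
  define ks where "ks = sorted_list_of_set K"
  define m where "m = length ks + 2"
  define g where "g z c t = (if c = 0 then 1 else if c = 1 then x z t A else x z t (ks ! (c - 2)))" for z c t
  define D where "D z = mat n m (\<lambda>(t, c). g z c t)" for z
  define u where "u z = transpose_mat (D z) *\<^sub>v vec n (\<lambda>t. x z t Y)" for z
  have g: "t < n \<Longrightarrow> (\<lambda>z. g z c t) \<in> borel_measurable N" for c t
    using x by (simp add: g_def)
  have D: "D z \<in> carrier_mat n m" for z by (simp add: D_def)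
  have G: "transpose_mat (D z) * D z \<in> carrier_mat m m" for z using D[of z] by simp
  have G_index: "(transpose_mat (D z) * D z) $$ (i, j) = (\<Sum>t<n. g z i t * g z j t)" if "i < m" "j < m" for z i j
    using that by (simp add: D_def scalar_prod_def lessThan_atLeast0)
  have u: "u z \<in> carrier_vec m" for z using D[of z] by (simp add: u_def)
  have u_index: "vec_index (u z) i = (\<Sum>t<n. g z i t * x z t Y)" if "i < m" for z i
    using that by (simp add: u_def D_def scalar_prod_def lessThan_atLeast0)
  have "ols_coef n (x z) A Y K = vec_index (minv (transpose_mat (D z) * D z) *\<^sub>v u z) 1" for z
    unfolding ols_coef_def Let_def D_def u_def g_def m_def ks_def by simp
  also have "\<dots> z = (\<Sum>j<m. minv (transpose_mat (D z) * D z) $$ (1, j) * vec_index (u z) j)" for z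
  proof (rule index_mult_mat_vec_sum[OF _ u])
    show "minv (transpose_mat (D z) * D z) \<in> carrier_mat m m"
      using adj_mat(1)[OF G[of z]] by (simp add: minv_def)
  qed (simp add: m_def)
  finally have eq: "ols_coef n (x z) A Y K = (\<Sum>j<m. minv (transpose_mat (D z) * D z) $$ (1, j) * vec_index (u z) j)" for z .
  show ?thesis
    unfolding eq
  proof (intro borel_measurable_sum borel_measurable_times)
    fix j assume j: "j \<in> {..<m}"
    show "(\<lambda>z. minv (transpose_mat (D z) * D z) $$ (1, j)) \<in> borel_measurable N"
    proof (rule minv_measurable[OF G])
      fix i j assume "i < m" "j < m"
      then show "(\<lambda>z. (transpose_mat (D z) * D z) $$ (i, j)) \<in> borel_measurable N"
        unfolding G_index[OF \<open>i < m\<close> \<open>j < m\<close>] by (intro borel_measurable_sum borel_measurable_times g) auto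
    qed (use j in \<open>auto simp: m_def\<close>)
    show "(\<lambda>z. vec_index (u z) j) \<in> borel_measurable N"
      using j by (simp add: u_index) (intro borel_measurable_sum borel_measurable_times g x; simp)
  qed
qed

lemma ols_coef_cong:
  assumes "finite K" "\<And>t v. t < n \<Longrightarrow> v \<in> insert A (insert Y K) \<Longrightarrow> x t v = x' t v"
  shows "ols_coef n x A Y K = ols_coef n x' A Y K"
proof -
  let ?ks = "sorted_list_of_set K"
  have "?ks ! j \<in> K" if "j < length ?ks" for j
    using nth_mem[OF that] assms(1) by simp
  then have "mat n (length ?ks + 2) (\<lambda>(t, c). if c = 0 then 1 else if c = 1 then x t A else x t (?ks ! (c - 2)))
    = mat n (length ?ks + 2) (\<lambda>(t, c). if c = 0 then 1 else if c = 1 then x' t A else x' t (?ks ! (c - 2)))"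
    using assms(2) by (intro cong_mat) auto
  moreover have "vec n (\<lambda>t. x t Y) = vec n (\<lambda>t. x' t Y)"
    using assms(2) by (intro eq_vecI) auto
  ultimately show ?thesis unfolding ols_coef_def Let_def by simp
qed

section \<open>Samples as linear forms in independent standard normal variables\<close>

locale gaussian_sample =
  fixes V :: "'v::linorder set" and C :: "'v \<Rightarrow> 'v \<Rightarrow> real" and n :: nat
  assumes finite_V: "finite V" and indep: "lin_indep V C"
begin

definition I :: "(nat \<times> 'v) set" where
  "I = {..<n} \<times> V"

text \<open>As a direction of translation this perturbs observation \<open>t\<close> alone.\<close>

definition row_form :: "nat \<Rightarrow> ('v \<Rightarrow> real) \<Rightarrow> nat \<times> 'v \<Rightarrow> real" where
  "row_form t e = (\<lambda>(s, i). if s = t then e i else 0)"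

text \<open>The value 0 outside the sample makes invariance under translations an identity of functions.\<close>

definition obs :: "('v \<Rightarrow> real) \<Rightarrow> (nat \<times> 'v \<Rightarrow> real) \<Rightarrow> nat \<Rightarrow> real" where
  "obs e z t = (if t < n then lin_form V e (\<lambda>i. z (t, i)) else 0)"

lemma finite_I: "finite I"
  by (simp add: I_def finite_V)

lemma sum_I_row: "t < n \<Longrightarrow> (\<Sum>i\<in>I. row_form t e i * f i) = (\<Sum>i\<in>V. e i * f (t, i))"
proof -
  assume t: "t < n"
  have "(\<Sum>i\<in>I. row_form t e i * f i) = (\<Sum>s<n. \<Sum>i\<in>V. row_form t e (s, i) * f (s, i))"
    unfolding I_def by (simp add: sum.cartesian_product)
  also have "\<dots> = (\<Sum>s<n. if s = t then (\<Sum>i\<in>V. e i * f (s, i)) else 0)"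
    by (intro sum.cong refl) (simp add: row_form_def)
  finally show ?thesis using t by simp
qed

lemma lin_form_row: "t < n \<Longrightarrow> lin_form I (row_form t e) z = obs e z t"
  by (simp add: lin_form_def[of I] sum_I_row) (simp add: obs_def lin_form_def)

lemma row_row: "s < n \<Longrightarrow> (\<Sum>i\<in>I. row_form s f i * row_form t e i) = (if s = t then lin_form V f e else 0)"
  by (simp add: sum_I_row) (simp add: row_form_def lin_form_def)

lemma obs_translate:
  "obs f (translate I (row_form t e) h z) s = obs f z s + (if s = t \<and> s < n then h * lin_form V f e else 0)"
proof (cases "s < n")
  case True
  then show ?thesis
    by (simp add: lin_form_row[symmetric] lin_form_translate row_row)
qed (simp add: obs_def)

lemma obs_measurable [measurable]: "(\<lambda>z. obs e z t) \<in> borel_measurable (gauss I)"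
proof (cases "t < n")
  case True
  then show ?thesis using lin_form_measurable[of I "row_form t e"] by (simp add: lin_form_row[OF True, abs_def])
qed (simp add: obs_def)

lemma obs_combination:
  "obs (\<lambda>i. e i - (\<Sum>u\<in>T. d u * C u i)) z t = obs e z t - (\<Sum>u\<in>T. d u * obs (C u) z t)"
  by (simp add: obs_def lin_form_diff_left lin_form_sum_left)

text \<open>The intercept stands last, so it is orthogonalised first and adding a covariate is a
  \<open>Cons\<close>. The columns remain functions of the sample, as
  \<open>gsproj_measurable\<close> requires.\<close>

definition cols :: "('v \<Rightarrow> real) list \<Rightarrow> ((nat \<times> 'v \<Rightarrow> real) \<Rightarrow> nat \<Rightarrow> real) list" where
  "cols es = map obs es @ [\<lambda>_ _. 1]"

definition design :: "('v \<Rightarrow> real) list \<Rightarrow> (nat \<times> 'v \<Rightarrow> real) \<Rightarrow> (nat \<Rightarrow> real) list" where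
  "design es z = map (\<lambda>g. g z) (cols es)"

lemma design_Cons: "design (e # es) z = obs e z # design es z"
  by (simp add: design_def cols_def)

lemma length_design: "length (design es z) = Suc (length es)"
  by (simp add: design_def cols_def)

definition resid :: "('v \<Rightarrow> real) list \<Rightarrow> ('v \<Rightarrow> real) \<Rightarrow> (nat \<times> 'v \<Rightarrow> real) \<Rightarrow> nat \<Rightarrow> real" where
  "resid es a z = gsres n (design es z) (obs a z)"

definition rss :: "('v \<Rightarrow> real) list \<Rightarrow> ('v \<Rightarrow> real) \<Rightarrow> (nat \<times> 'v \<Rightarrow> real) \<Rightarrow> real" where
  "rss es a z = dotn n (resid es a z) (resid es a z)"

lemma proj_measurable [measurable]: "(\<lambda>z. gsproj n (design es z) s t) \<in> borel_measurable (gauss I)"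
  unfolding design_def
  by (rule gsproj_measurable) (auto simp: cols_def)

lemma resid_measurable [measurable]: "(\<lambda>z. resid es a z t) \<in> borel_measurable (gauss I)"
  unfolding resid_def matapp_def by measurable

lemma rss_measurable [measurable]: "rss es a \<in> borel_measurable (gauss I)"
  unfolding rss_def[abs_def] dotn_def by measurable

lemma rss_nonneg: "0 \<le> rss es a z"
  unfolding rss_def by (rule dotn_self_nonneg)

lemma design_translate:
  assumes "\<And>f. f \<in> set es \<Longrightarrow> lin_form V f e = 0"
  shows "design es (translate I (row_form t e) h z) = design es z"
proof -
  have "obs f (translate I (row_form t e) h z) = obs f z" if "f \<in> set es" for f
    using assms[OF that] by (intro ext) (simp add: obs_translate)
  then show ?thesis by (simp add: design_def cols_def)
qed

lemma resid_translate:
  assumes "\<And>f. f \<in> set es \<Longrightarrow> lin_form V f e = 0" and t: "t < n"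
  shows "resid es a (translate I (row_form t e) h z) s = resid es a z s + h * lin_form V a e * gsproj n (design es z) s t"
proof -
  have D: "design es (translate I (row_form t e) h z) = design es z" by (rule design_translate) (rule assms(1))
  have "resid es a (translate I (row_form t e) h z) s
      = (\<Sum>u<n. gsproj n (design es z) s u * (obs a z u + (if u = t then h * lin_form V a e else 0)))"
    unfolding resid_def D matapp_def by (intro sum.cong refl) (simp add: obs_translate)
  also have "\<dots> = resid es a z s + (\<Sum>u<n. if u = t then gsproj n (design es z) s t * (h * lin_form V a e) else 0)"
    unfolding resid_def matapp_def sum.distrib[symmetric] by (intro sum.cong refl) (simp add: distrib_left)
  finally show ?thesis using t by (simp add: mult_ac)
qed

text \<open>The population counterpart of \<open>gs_ok\<close>: each variable can be moved in some
  direction \<open>e\<close> that leaves all later ones fixed. Such a direction is what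
  \<open>null_transversal\<close> needs.\<close>

fun successive_residuals :: "('v \<Rightarrow> real) list \<Rightarrow> bool" where
  "successive_residuals [] = True"
| "successive_residuals (f # es) \<longleftrightarrow> successive_residuals es \<and>
     (\<exists>e. (\<forall>g\<in>set es. lin_form V g e = 0) \<and> lin_form V f e \<noteq> 0)"

text \<open>When row t is translated by h along e, the residual of f at t is affine in h with slope
  <f, e> P_tt. Where P_tt is nonzero it vanishes at most once on each line, so this event is null.
  Some P_tt is nonzero because the trace n - 1 - \<open>length es\<close> is positive.\<close>

lemma AE_gs_ok:
  "successive_residuals es \<Longrightarrow> length es < n \<Longrightarrow> AE z in gauss I. gs_ok n (design es z)"
proof (induction es)
  case Nil
  have "dotn n (gsres n [] (\<lambda>_. 1)) (gsres n [] (\<lambda>_. 1)) = dotn n (\<lambda>_. 1) (\<lambda>_. 1)"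
    by (rule dotn_cong) (simp_all only: gsres_Nil)
  also have "\<dots> \<noteq> 0" using Nil by (simp add: dotn_def)
  finally have "gs_ok n (design [] z)" for z by (simp only: design_def cols_def list.map append_Nil gs_ok.simps simp_thms) 
  then show ?case by simp
next
  case (Cons f es)
  then obtain e where e: "\<And>g. g \<in> set es \<Longrightarrow> lin_form V g e = 0" and fe: "lin_form V f e \<noteq> 0" by auto
  have "AE z in gauss I. gsproj n (design es z) t t \<noteq> 0 \<longrightarrow> resid es f z t \<noteq> 0" if t: "t < n" for t
  proof -
    define B where "B = {z \<in> space (gauss I). gsproj n (design es z) t t \<noteq> 0 \<and> resid es f z t = 0}"
    have B: "B \<in> sets (gauss I)" unfolding B_def by measurable
    have "emeasure (gauss I) B = 0"
    proof (rule null_transversal[OF finite_I B, where c = "row_form t e"])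
      fix z h assume "z \<in> B" "h \<noteq> (0::real)"
      then show "translate I (row_form t e) h z \<notin> B"
        using fe by (simp add: B_def resid_translate[OF e t])
    qed
    then have "B \<in> null_sets (gauss I)" using B by (simp add: null_sets_def)
    then have "AE z in gauss I. z \<notin> B" by (rule AE_not_in)
    then show ?thesis using AE_space by eventually_elim (auto simp: B_def)
  qed
  then have "AE z in gauss I. \<forall>t\<in>{..<n}. gsproj n (design es z) t t \<noteq> 0 \<longrightarrow> resid es f z t \<noteq> 0"
    by (intro AE_finite_allI) simp_all
  moreover have "AE z in gauss I. gs_ok n (design es z)" using Cons by simp
  ultimately show ?case
  proof eventually_elim
    case (elim z)
    have "(\<Sum>t<n. gsproj n (design es z) t t) \<noteq> 0"
      unfolding gsproj_trace[OF elim(2)] length_design using Cons.prems(2) by simp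
    then obtain t where "t \<in> {..<n}" "gsproj n (design es z) t t \<noteq> 0"
      by (rule sum.not_neutral_contains_not_neutral)
    then have "\<not> (\<forall>t<n. resid es f z t = 0)" using elim(1) by blast
    then have "dotn n (resid es f z) (resid es f z) \<noteq> 0" unfolding dotn_self_eq_0 .
    then show ?case using elim(2) unfolding design_Cons gs_ok.simps resid_def by simp
  qed
qed

text \<open>The direction for \<open>C v\<close> is its population residual given the later
  variables; its pairing with \<open>C v\<close> is a positive partial variance.\<close>

lemma successive_residuals_C:
  "distinct vs \<Longrightarrow> set vs \<subseteq> V \<Longrightarrow> successive_residuals (map C vs)"
proof (induction vs)
  case (Cons v vs)
  obtain d where d: "\<And>x. x \<in> set vs \<Longrightarrow> lin_form V (\<lambda>i. C v i - (\<Sum>u\<in>set vs. d u * C u i)) (C x) = 0"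
    "lin_form V (\<lambda>i. C v i - (\<Sum>u\<in>set vs. d u * C u i)) (C v) = partial_cov (\<lambda>u w. lin_form V (C u) (C w)) v v (set vs)"
    "0 < partial_cov (\<lambda>u w. lin_form V (C u) (C w)) v v (set vs)"
    by (rule population_regression[OF finite_V indep, of "\<lambda>u w. lin_form V (C u) (C w)" "set vs" v]) (use Cons.prems in auto)
  let ?e = "\<lambda>i. C v i - (\<Sum>u\<in>set vs. d u * C u i)"
  have "lin_form V ?e (C v) \<noteq> 0" using d(2,3) by linarith
  then have "lin_form V (C v) ?e \<noteq> 0" by (subst lin_form_commute)
  moreover have "\<forall>g\<in>set (map C vs). lin_form V g ?e = 0"
  proof
    fix g assume "g \<in> set (map C vs)"
    then obtain x where x: "x \<in> set vs" "g = C x" by auto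
    show "lin_form V g ?e = 0" unfolding x(2) by (subst lin_form_commute) (rule d(1)[OF x(1)])
  qed
  ultimately show ?case using Cons by (auto simp only: list.map successive_residuals.simps distinct.simps list.set)
qed simp

lemma AE_rss_pos:
  assumes "successive_residuals (a # es)" "Suc (length es) < n"
  shows "AE z in gauss I. 0 < rss es a z"
proof -
  have "AE z in gauss I. gs_ok n (design (a # es) z)"
    using AE_gs_ok[OF assms(1)] assms(2) by simp
  then show ?thesis
  proof eventually_elim
    case (elim z)
    then have "rss es a z \<noteq> 0" by (simp only: design_Cons gs_ok.simps rss_def resid_def) simp
    then show ?case using rss_nonneg[of es a z] by simp
  qed
qed

lemma resid_orthogonal:
  assumes "f \<in> set (design es z)"
  shows "dotn n (resid es a z) f = 0"
proof -
  have "dotn n (resid es a z) f = dotn n (obs a z) (gsres n (design es z) f)"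
    unfolding resid_def by (rule gsproj_self_adjoint)
  also have "\<dots> = 0" unfolding dotn_def using gsres_kills[OF assms] by (intro sum.neutral) simp
  finally show ?thesis .
qed

lemma resid_obs: "dotn n (resid es a z) (obs a z) = rss es a z"
  unfolding rss_def resid_def dotn_gsres_gsres by (rule dotn_commute)

lemma resid_proj: "t < n \<Longrightarrow> (\<Sum>s<n. resid es a z s * gsproj n (design es z) s t) = resid es a z t"
  using gsproj_idem[of t n "design es z" "obs a z"]
  by (simp add: resid_def matapp_def[of n "gsproj n (design es z)" "matapp n _ _"] gsproj_sym[of n _ t] mult.commute)

lemma resid_le_rss: "t < n \<Longrightarrow> (resid es a z t)\<^sup>2 \<le> rss es a z"
  unfolding rss_def dotn_def
  by (rule order.trans[OF _ member_le_sum[where i = t]]) (simp_all add: power2_eq_square)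

section \<open>Stein's identity with a regularised denominator\<close>

lemma ridge_bound:
  fixes x y \<delta> :: real
  assumes "x\<^sup>2 \<le> y" "0 < \<delta>" "\<delta> \<le> 1"
  shows "\<bar>x / (y + \<delta>)\<bar> \<le> 1 / \<delta>"
proof -
  have "\<bar>x\<bar> * \<delta> \<le> y + \<delta>"
  \<comment> \<open>A small x is controlled by the summand \<delta>, a large one by |x| <= x^2 <=
    y.\<close>
  proof (cases "\<bar>x\<bar> \<le> 1")
    case True
    then have "\<bar>x\<bar> * \<delta> \<le> 1 * \<delta>" using assms by (intro mult_right_mono) auto
    moreover have "0 \<le> y" using assms(1) zero_le_power2[of x] by linarith
    ultimately show ?thesis by simp
  next
    case False
    have "\<bar>x\<bar> * \<delta> \<le> \<bar>x\<bar> * 1" using assms by (intro mult_left_mono) auto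
    also have "\<dots> \<le> \<bar>x\<bar> * \<bar>x\<bar>" using False by (intro mult_left_mono) auto
    also have "\<dots> = x\<^sup>2" by (simp add: power2_eq_square)
    finally show ?thesis using assms by simp
  qed
  moreover have "0 < y + \<delta>" using assms zero_le_power2[of x] by linarith
  ultimately show ?thesis using assms by (simp add: abs_div field_simps)
qed

text \<open>Stein's identity for component t of the field, row t being moved along \<open>e\<close>.
  The residual at t moves with speed v P_tt, and \<open>rss\<close> with speed 2 v times the sum of
  r_s P_st, which is 2 v r_t because P r = r. The quotient rule yields \<open>G\<close>; \<delta>
  bounds both the field and \<open>G\<close>.\<close>

lemma stein_ridge:
  fixes a e :: "'v \<Rightarrow> real" and \<delta> :: real
  assumes e: "\<And>f. f \<in> set es \<Longrightarrow> lin_form V f e = 0" and t: "t < n" and \<delta>: "0 < \<delta>" "\<delta> \<le> 1"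
  defines "v \<equiv> lin_form V a e"
  defines "G \<equiv> \<lambda>z. v * (gsproj n (design es z) t t / (rss es a z + \<delta>) - 2 * (resid es a z t)\<^sup>2 / (rss es a z + \<delta>)\<^sup>2)"
  shows "integrable (gauss I) (\<lambda>z. resid es a z t / (rss es a z + \<delta>) * obs e z t)"
    "integrable (gauss I) G"
    "(\<integral>z. resid es a z t / (rss es a z + \<delta>) * obs e z t \<partial>gauss I) = (\<integral>z. G z \<partial>gauss I)"
proof -
  interpret prob_space "gauss I" by (rule prob_space_gauss)
  let ?r = "resid es a" and ?q = "rss es a" and ?P = "\<lambda>z. gsproj n (design es z)"
  have qd: "0 < ?q z + \<delta>" for z using rss_nonneg[of es a z] \<delta> by linarith
  have bF: "\<bar>?r z t / (?q z + \<delta>)\<bar> \<le> 1 / \<delta>" for z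
    using ridge_bound[OF resid_le_rss[OF t] \<delta>] .
  have bG: "\<bar>G z\<bar> \<le> \<bar>v\<bar> * (1 / \<delta> + 2 * (1 / \<delta>)\<^sup>2)" for z
  proof -
    have "\<bar>?P z t t / (?q z + \<delta>)\<bar> \<le> 1 / \<delta>"
      using gsproj_diag_le_1[OF t, of "design es z"] rss_nonneg[of es a z] \<delta> qd[of z]
      unfolding abs_divide by (intro frac_le) auto
    moreover have "\<bar>2 * (?r z t)\<^sup>2 / (?q z + \<delta>)\<^sup>2\<bar> \<le> 2 * (1 / \<delta>)\<^sup>2"
      using power_mono[OF bF[of z], of 2] by (simp add: power_divide)
    ultimately have "\<bar>?P z t t / (?q z + \<delta>) - 2 * (?r z t)\<^sup>2 / (?q z + \<delta>)\<^sup>2\<bar> \<le> 1 / \<delta> + 2 * (1 / \<delta>)\<^sup>2"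
      by linarith
    then show ?thesis unfolding G_def abs_mult by (rule mult_left_mono) simp
  qed
  have der: "((\<lambda>h. ?r (translate I (row_form t e) h z) t / (?q (translate I (row_form t e) h z) + \<delta>)) has_real_derivative
      G (translate I (row_form t e) h z)) (at h)" for z h
  proof -
    let ?z = "translate I (row_form t e) h z"
    have D: "design es (translate I (row_form t e) k z) = design es z" for k by (rule design_translate) (rule e)
    have R: "?r (translate I (row_form t e) k z) s = ?r z s + k * v * ?P z s t" for k s
      unfolding v_def by (rule resid_translate[OF _ t]) (rule e)
    have R': "((\<lambda>h. ?r (translate I (row_form t e) h z) s) has_real_derivative v * ?P z s t) (at h)" for s
      unfolding R by (auto intro!: derivative_eq_intros)
    have "((\<lambda>h. ?q (translate I (row_form t e) h z)) has_real_derivative (\<Sum>s<n. ?r ?z s * (v * ?P z s t) + v * ?P z s t * ?r ?z s)) (at h)"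
      unfolding rss_def dotn_def by (intro DERIV_sum DERIV_mult' R')
    also have "(\<Sum>s<n. ?r ?z s * (v * ?P z s t) + v * ?P z s t * ?r ?z s) = 2 * v * (\<Sum>s<n. ?r ?z s * ?P ?z s t)"
      unfolding D sum_distrib_left by (intro sum.cong refl) simp
    also have "\<dots> = 2 * v * ?r ?z t" by (simp only: resid_proj[OF t])
    finally have Q': "((\<lambda>h. ?q (translate I (row_form t e) h z) + \<delta>) has_real_derivative 2 * v * ?r ?z t) (at h)"
      by (auto intro!: derivative_eq_intros)
    have "((\<lambda>h. ?r (translate I (row_form t e) h z) t / (?q (translate I (row_form t e) h z) + \<delta>)) has_real_derivative
        (v * ?P z t t * (?q ?z + \<delta>) - ?r ?z t * (2 * v * ?r ?z t)) / ((?q ?z + \<delta>) * (?q ?z + \<delta>))) (at h)"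
      using qd[of ?z] by (intro DERIV_divide R' Q') simp
    also have "(v * ?P z t t * (?q ?z + \<delta>) - ?r ?z t * (2 * v * ?r ?z t)) / ((?q ?z + \<delta>) * (?q ?z + \<delta>)) = G ?z"
      using qd[of ?z] unfolding G_def D by (simp add: divide_simps power2_eq_square) (simp add: algebra_simps)
    finally show ?thesis .
  qed
  have G: "G \<in> borel_measurable (gauss I)" unfolding G_def by measurable
  have F: "(\<lambda>z. ?r z t / (?q z + \<delta>)) \<in> borel_measurable (gauss I)" by measurable
  show "integrable (gauss I) G"
    by (rule integrable_const_bound[where B = "\<bar>v\<bar> * (1 / \<delta> + 2 * (1 / \<delta>)\<^sup>2)"]) (use bG G in auto)
  show "integrable (gauss I) (\<lambda>z. ?r z t / (?q z + \<delta>) * obs e z t)"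
    "(\<integral>z. ?r z t / (?q z + \<delta>) * obs e z t \<partial>gauss I) = (\<integral>z. G z \<partial>gauss I)"
    using stein[OF finite_I F G bF bG der] by (simp_all only: lin_form_row[OF t])
qed

section \<open>The inverse moment of the residual sum of squares\<close>

abbreviation covariates :: "'v set \<Rightarrow> ('v \<Rightarrow> real) list" where
  "covariates S \<equiv> map C (sorted_list_of_set S)"

lemma set_covariates: "S \<subseteq> V \<Longrightarrow> set (covariates S) = C ` S"
  using finite_subset[OF _ finite_V, of S] by simp

lemma successive_residuals_covariates:
  assumes "S \<subseteq> V" "A \<in> V" "A \<notin> S"
  shows "successive_residuals (C A # covariates S)"
proof -
  have "finite S" using assms(1) finite_V finite_subset by blast
  then show ?thesis
    using successive_residuals_C[of "A # sorted_list_of_set S"] assms by simp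
qed

lemma resid_covariate: "S \<subseteq> V \<Longrightarrow> u \<in> S \<Longrightarrow> dotn n (resid (covariates S) a z) (obs (C u) z) = 0"
  using finite_subset[OF _ finite_V, of S]
  by (intro resid_orthogonal) (auto simp: design_def cols_def)

text \<open>Summing \<open>stein_ridge\<close> over the rows gives \<open>balance\<close>, which is
  used twice. Dropping its error term bounds E(1/(q + \<delta>)) uniformly, so 1/q is integrable by
  monotone convergence. With 1/q as majorant the error term then tends to 0 and the left side to 1,
  which leaves 1 = v (m - 2) E(1/q).\<close>

lemma inverse_rss_moment:
  assumes S: "S \<subseteq> V" and A: "A \<in> V" "A \<notin> S" and n: "card S + 3 < n"
    and orth: "\<And>x. x \<in> S \<Longrightarrow> lin_form V (\<lambda>i. C A i - (\<Sum>u\<in>S. d u * C u i)) (C x) = 0"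
    and v: "lin_form V (\<lambda>i. C A i - (\<Sum>u\<in>S. d u * C u i)) (C A) = v" "0 < v"
  shows "integrable (gauss I) (\<lambda>z. 1 / rss (covariates S) (C A) z)"
    "(\<integral>z. 1 / rss (covariates S) (C A) z \<partial>gauss I) = 1 / (v * (real n - real (card S) - 3))"
proof -
  interpret prob_space "gauss I" by (rule prob_space_gauss)
  define es where "es = covariates S"
  define e where "e = (\<lambda>i. C A i - (\<Sum>u\<in>S. d u * C u i))"
  define q where "q = rss es (C A)"
  define r where "r = resid es (C A)"
  define P where "P z = gsproj n (design es z)" for z
  define m where "m = real n - real (card S) - 1"
  have m: "2 < m" using n by (simp add: m_def)
  have qm [measurable]: "q \<in> borel_measurable (gauss I)" by (simp add: q_def)
  have q0: "0 \<le> q z" for z by (simp add: q_def rss_nonneg)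
  have es_e: "lin_form V f e = 0" if "f \<in> set es" for f
  proof -
    from that obtain x where x: "x \<in> S" "f = C x" using set_covariates[OF S] by (auto simp: es_def)
    show ?thesis unfolding x(2) using orth[OF x(1)] by (subst lin_form_commute) (simp add: e_def)
  qed
  have v': "lin_form V (C A) e = v" using v(1) by (subst lin_form_commute) (simp add: e_def)
  have sr: "successive_residuals (C A # es)" unfolding es_def by (rule successive_residuals_covariates[OF S A])
  have len: "length es = card S" by (simp add: es_def)
  have pos: "AE z in gauss I. 0 < q z"
    unfolding q_def by (rule AE_rss_pos[OF sr]) (use n len in simp)
  have tr: "AE z in gauss I. (\<Sum>t<n. P z t t) = m"
  proof -
    have "AE z in gauss I. gs_ok n (design es z)"
      by (rule AE_gs_ok) (use sr n len in auto)
    then show ?thesis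
      by eventually_elim (simp add: gsproj_trace P_def length_design len m_def)
  qed
  \<comment> \<open>\<open>e\<close> differs from \<open>C A\<close> by a combination of covariates,
    whose columns are orthogonal to the residual.\<close>
  have re: "(\<Sum>t<n. r z t * obs e z t) = q z" for z
  proof -
    have "(\<Sum>t<n. r z t * obs e z t) = dotn n (r z) (\<lambda>t. obs (C A) z t - (\<Sum>u\<in>S. d u * obs (C u) z t) * 1)"
      unfolding dotn_def e_def obs_combination by simp
    also have "\<dots> = q z - (\<Sum>u\<in>S. d u * dotn n (r z) (obs (C u) z)) * 1"
      unfolding dotn_diff_scale dotn_sum_right by (simp add: r_def q_def resid_obs)
    also have "(\<Sum>u\<in>S. d u * dotn n (r z) (obs (C u) z)) = 0"
      by (intro sum.neutral ballI) (simp add: r_def es_def resid_covariate[OF S])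
    finally show ?thesis by simp
  qed
  have rr: "(\<Sum>t<n. (r z t)\<^sup>2) = q z" for z
    by (simp add: q_def rss_def r_def dotn_def power2_eq_square)
  define \<delta> where "\<delta> k = inverse (real (Suc k))" for k
  have \<delta>: "0 < \<delta> k" "\<delta> k \<le> 1" "\<delta> \<longlonglongrightarrow> 0" for k
    unfolding \<delta>_def[abs_def] by (rule inverse_Suc_null_sequence)+
  have qd: "0 < q z + \<delta> k" for z k using q0[of z] \<delta>(1)[of k] by linarith
  have ridge: "integrable (gauss I) (\<lambda>z. q z / (q z + \<delta> k))"
    "(\<integral>z. q z / (q z + \<delta> k) \<partial>gauss I) = (\<integral>z. v * (m / (q z + \<delta> k) - 2 * q z / (q z + \<delta> k)\<^sup>2) \<partial>gauss I)" for k
  proof -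
    let ?G = "\<lambda>t z. v * (P z t t / (q z + \<delta> k) - 2 * (r z t)\<^sup>2 / (q z + \<delta> k)\<^sup>2)"
    let ?F = "\<lambda>t z. r z t / (q z + \<delta> k) * obs e z t"
    have s: "integrable (gauss I) (?F t)" "integrable (gauss I) (?G t)"
      "(\<integral>z. ?F t z \<partial>gauss I) = (\<integral>z. ?G t z \<partial>gauss I)" if "t \<in> {..<n}" for t
      using stein_ridge[of es e t "\<delta> k" "C A"] es_e that \<delta> by (simp_all add: v' P_def q_def r_def)
    have F: "(\<Sum>t<n. ?F t z) = q z / (q z + \<delta> k)" for z
      by (subst re[symmetric]) (simp add: sum_divide_distrib)
    have "integrable (gauss I) (\<lambda>z. \<Sum>t<n. ?F t z)" using s(1) by (rule Bochner_Integration.integrable_sum)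
    then show "integrable (gauss I) (\<lambda>z. q z / (q z + \<delta> k))" by (simp only: F)
    have "(\<integral>z. q z / (q z + \<delta> k) \<partial>gauss I) = (\<Sum>t<n. \<integral>z. ?F t z \<partial>gauss I)"
      unfolding F[symmetric] using s(1) by (rule Bochner_Integration.integral_sum)
    also have "\<dots> = (\<Sum>t<n. \<integral>z. ?G t z \<partial>gauss I)" using s(3) by (rule sum.cong[OF refl])
    also have "\<dots> = (\<integral>z. (\<Sum>t<n. ?G t z) \<partial>gauss I)"
      using s(2) by (rule Bochner_Integration.integral_sum[symmetric])
    also have "\<dots> = (\<integral>z. v * (m / (q z + \<delta> k) - 2 * q z / (q z + \<delta> k)\<^sup>2) \<partial>gauss I)"
    proof (rule integral_cong_AE)
      show "(\<lambda>z. \<Sum>t<n. ?G t z) \<in> borel_measurable (gauss I)"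
        using s(2) by (intro borel_measurable_sum borel_measurable_integrable)
      show "AE z in gauss I. (\<Sum>t<n. ?G t z) = v * (m / (q z + \<delta> k) - 2 * q z / (q z + \<delta> k)\<^sup>2)"
        using tr
      proof eventually_elim
        case (elim z)
        have "(\<Sum>t<n. ?G t z) = v * ((\<Sum>t<n. P z t t) / (q z + \<delta> k) - 2 * (\<Sum>t<n. (r z t)\<^sup>2) / (q z + \<delta> k)\<^sup>2)"
          by (simp add: sum_distrib_left[symmetric] sum_subtractf sum_divide_distrib[symmetric])
        then show ?case unfolding elim rr .
      qed
    qed measurable
    finally show "(\<integral>z. q z / (q z + \<delta> k) \<partial>gauss I) = (\<integral>z. v * (m / (q z + \<delta> k) - 2 * q z / (q z + \<delta> k)\<^sup>2) \<partial>gauss I)" .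
  qed
  let ?inv = "\<lambda>k z. 1 / (q z + \<delta> k)"
  \<comment> \<open>Writing q = (q + \<delta>) - \<delta> in the numerator of 2 q / (q + \<delta>)^2
    yields twice \<open>?inv\<close> minus this term.\<close>
  let ?err = "\<lambda>k z. 2 * \<delta> k / (q z + \<delta> k)\<^sup>2"
  have inv_le: "?inv k z \<le> 1 / \<delta> k" for k z
    using q0[of z] \<delta>(1)[of k] by (intro divide_left_mono) (auto intro: mult_pos_pos add_nonneg_pos)
  have err_le: "?err k z \<le> 2 * ?inv k z" for k z
  proof -
    have "?err k z \<le> 2 * (q z + \<delta> k) / (q z + \<delta> k)\<^sup>2"
      using q0[of z] by (intro divide_right_mono) auto
    also have "\<dots> = 2 * ?inv k z"
    proof -
      have "2 * x / x\<^sup>2 = 2 * (1 / x)" if "x \<noteq> 0" for x :: real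
        using that by (simp add: power2_eq_square)
      then show ?thesis using qd[of z k] by (metis less_irrefl)
    qed
    finally show ?thesis .
  qed
  have int_inv: "integrable (gauss I) (?inv k)" for k
    by (rule integrable_const_bound[where B = "1 / \<delta> k"])
      (use inv_le qd in \<open>auto simp: abs_of_pos intro!: AE_I2\<close>)
  have int_err: "integrable (gauss I) (?err k)" for k
  proof (rule Bochner_Integration.integrable_bound)
    show "integrable (gauss I) (\<lambda>z. 2 * ?inv k z)" using int_inv by (rule integrable_mult_right)
    show "AE z in gauss I. norm (?err k z) \<le> norm (2 * ?inv k z)"
    proof (rule AE_I2)
      fix z
      have "norm (?err k z) = ?err k z" using \<delta>(1)[of k] by simp
      also have "\<dots> \<le> 2 * ?inv k z" by (rule err_le)
      also have "\<dots> \<le> norm (2 * ?inv k z)" unfolding real_norm_def by (rule abs_ge_self)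
      finally show "norm (?err k z) \<le> norm (2 * ?inv k z)" .
    qed
  qed measurable
  have balance: "(\<integral>z. q z / (q z + \<delta> k) \<partial>gauss I) = v * ((m - 2) * (\<integral>z. ?inv k z \<partial>gauss I) + (\<integral>z. ?err k z \<partial>gauss I))" for k
  proof -
    have "v * (m / (q z + \<delta> k) - 2 * q z / (q z + \<delta> k)\<^sup>2) = v * ((m - 2) * ?inv k z + ?err k z)" for z
      using qd[of z k] by (simp add: divide_simps power2_eq_square) (simp add: algebra_simps)
    then have "(\<integral>z. q z / (q z + \<delta> k) \<partial>gauss I) = (\<integral>z. v * ((m - 2) * ?inv k z + ?err k z) \<partial>gauss I)"
      unfolding ridge(2) by (intro Bochner_Integration.integral_cong refl)
    also have "\<dots> = v * (\<integral>z. (m - 2) * ?inv k z + ?err k z \<partial>gauss I)" by (rule integral_mult_right_zero)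
    also have "(\<integral>z. (m - 2) * ?inv k z + ?err k z \<partial>gauss I) = (\<integral>z. (m - 2) * ?inv k z \<partial>gauss I) + (\<integral>z. ?err k z \<partial>gauss I)"
      using int_inv int_err by (intro Bochner_Integration.integral_add integrable_mult_right)
    also have "(\<integral>z. (m - 2) * ?inv k z \<partial>gauss I) = (m - 2) * (\<integral>z. ?inv k z \<partial>gauss I)"
      by (rule integral_mult_right_zero)
    finally show ?thesis .
  qed
  have frac_le: "q z / (q z + \<delta> k) \<le> 1" and frac_nonneg: "0 \<le> q z / (q z + \<delta> k)" for z k
    using q0[of z] \<delta>(1)[of k] qd[of z k] by (simp_all add: divide_simps)
  \<comment> \<open>The error has a nonnegative integral and the left side of \<open>balance\<close>
    is at most 1; dividing by v (m - 2) uses m > 2.\<close>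
  have bound: "(\<integral>z. ?inv k z \<partial>gauss I) \<le> 1 / (v * (m - 2))" for k
  proof -
    have "(\<integral>z. q z / (q z + \<delta> k) \<partial>gauss I) \<le> (\<integral>z. 1 \<partial>gauss I)"
      using ridge(1) frac_le by (intro integral_mono) auto
    also have "\<dots> = 1" by (simp add: prob_space)
    finally have 1: "v * ((m - 2) * (\<integral>z. ?inv k z \<partial>gauss I) + (\<integral>z. ?err k z \<partial>gauss I)) \<le> 1"
      by (simp only: balance)
    have "0 \<le> (\<integral>z. ?err k z \<partial>gauss I)"
      using \<delta>(1)[of k] by (intro Bochner_Integration.integral_nonneg) simp
    then have "0 \<le> v * (\<integral>z. ?err k z \<partial>gauss I)" using v(2) by simp
    with 1 have "v * (m - 2) * (\<integral>z. ?inv k z \<partial>gauss I) \<le> 1" by (simp add: distrib_left)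
    then show ?thesis using v(2) m by (simp add: pos_le_divide_eq mult.commute mult.left_commute)
  qed
  have \<delta>_mono: "\<delta> k' \<le> \<delta> k" if "k \<le> k'" for k k'
    unfolding \<delta>_def using that by (intro le_imp_inverse_le) auto
  have inv_mono: "?inv k z \<le> ?inv k' z" if "k \<le> k'" for k k' z
    using \<delta>_mono[OF that] qd[of z k'] qd[of z k] by (intro divide_left_mono) auto
  \<comment> \<open>Monotone convergence is applied in the form that takes the limit of the
    integrals as given; an increasing bounded sequence supplies it.\<close>
  have "\<exists>x. (\<lambda>k. \<integral>z. ?inv k z \<partial>gauss I) \<longlonglongrightarrow> x"
  proof (rule Bseq_monoseq_convergent[unfolded convergent_def])
    have inc: "incseq (\<lambda>k. \<integral>z. ?inv k z \<partial>gauss I)"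
      using int_inv inv_mono by (intro incseq_SucI integral_mono) auto
    then show "monoseq (\<lambda>k. \<integral>z. ?inv k z \<partial>gauss I)" by (rule incseq_imp_monoseq)
    have "0 \<le> (\<integral>z. ?inv k z \<partial>gauss I)" for k
      using qd by (intro Bochner_Integration.integral_nonneg) (simp add: less_imp_le)
    then show "Bseq (\<lambda>k. \<integral>z. ?inv k z \<partial>gauss I)"
      using bound by (intro BseqI'[of _ "1 / (v * (m - 2))"]) simp
  qed
  then obtain x where x: "(\<lambda>k. \<integral>z. ?inv k z \<partial>gauss I) \<longlonglongrightarrow> x" ..
  have lim_inv: "AE z in gauss I. (\<lambda>k. ?inv k z) \<longlonglongrightarrow> 1 / q z"
    using pos
  proof eventually_elim
    case (elim z)
    have "(\<lambda>k. 1 / (q z + \<delta> k)) \<longlonglongrightarrow> 1 / (q z + 0)"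
      using elim by (intro tendsto_intros \<delta>(3)) simp
    then show ?case by simp
  qed
  have int_q: "integrable (gauss I) (\<lambda>z. 1 / q z)"
  proof (rule integrable_monotone_convergence[OF int_inv _ lim_inv x])
    show "AE z in gauss I. mono (\<lambda>k. ?inv k z)"
      using inv_mono by (intro AE_I2 monoI) simp
  qed measurable
  have x_eq: "x = (\<integral>z. 1 / q z \<partial>gauss I)"
  proof (rule LIMSEQ_unique[OF x])
    show "(\<lambda>k. \<integral>z. ?inv k z \<partial>gauss I) \<longlonglongrightarrow> (\<integral>z. 1 / q z \<partial>gauss I)"
    proof (rule integral_dominated_convergence[OF _ _ int_q lim_inv])
      show "AE z in gauss I. norm (?inv k z) \<le> 1 / q z" for k
        using pos by eventually_elim (use \<delta>(1)[of k] in \<open>simp add: Fields.frac_le\<close>)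
    qed measurable
  qed
  have lim_err: "(\<lambda>k. \<integral>z. ?err k z \<partial>gauss I) \<longlonglongrightarrow> (\<integral>z. 0 \<partial>gauss I)"
  proof (rule integral_dominated_convergence[where w = "\<lambda>z. 2 * (1 / q z)"])
    show "integrable (gauss I) (\<lambda>z. 2 * (1 / q z))" using int_q by (rule integrable_mult_right)
    show "AE z in gauss I. (\<lambda>k. ?err k z) \<longlonglongrightarrow> 0"
      using pos
    proof eventually_elim
      case (elim z)
      have "(\<lambda>k. 2 * \<delta> k / (q z + \<delta> k)\<^sup>2) \<longlonglongrightarrow> 2 * 0 / (q z + 0)\<^sup>2"
        using elim by (intro tendsto_intros \<delta>(3)) simp
      then show ?case by simp
    qed
    show "AE z in gauss I. norm (?err k z) \<le> 2 * (1 / q z)" for k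
      using pos
    proof eventually_elim
      case (elim z)
      have "norm (?err k z) = ?err k z" using \<delta>(1)[of k] by simp
      also have "\<dots> \<le> 2 * ?inv k z" by (rule err_le)
      also have "\<dots> \<le> 2 * (1 / q z)"
        using elim \<delta>(1)[of k] by (intro mult_left_mono divide_left_mono) auto
      finally show ?case .
    qed
  qed measurable
  have lim_frac: "(\<lambda>k. \<integral>z. q z / (q z + \<delta> k) \<partial>gauss I) \<longlonglongrightarrow> (\<integral>z. 1 \<partial>gauss I)"
  proof (rule integral_dominated_convergence[where w = "\<lambda>z. 1"])
    show "AE z in gauss I. (\<lambda>k. q z / (q z + \<delta> k)) \<longlonglongrightarrow> 1"
      using pos
    proof eventually_elim
      case (elim z)
      have "(\<lambda>k. q z / (q z + \<delta> k)) \<longlonglongrightarrow> q z / (q z + 0)"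
        using elim by (intro tendsto_intros \<delta>(3)) simp
      then show ?case using elim by simp
    qed
    show "AE z in gauss I. norm (q z / (q z + \<delta> k)) \<le> 1" for k
      using frac_le frac_nonneg by (intro AE_I2) (simp only: real_norm_def abs_of_nonneg)
  qed simp_all
  have "(\<lambda>k. v * ((m - 2) * (\<integral>z. ?inv k z \<partial>gauss I) + (\<integral>z. ?err k z \<partial>gauss I))) \<longlonglongrightarrow> v * ((m - 2) * x + (\<integral>z. 0 \<partial>gauss I))"
    by (intro tendsto_intros x lim_err)
  with lim_frac have "(\<integral>z. 1 \<partial>gauss I) = v * ((m - 2) * x + (\<integral>z. 0 \<partial>gauss I))"
    unfolding balance by (rule LIMSEQ_unique)
  then have "1 = v * (m - 2) * x" by (simp add: prob_space)
  then have "x = 1 / (v * (m - 2))" using v(2) m by (simp add: field_simps)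
  then show "(\<integral>z. 1 / rss (covariates S) (C A) z \<partial>gauss I) = 1 / (v * (real n - real (card S) - 3))"
    using x_eq by (simp add: q_def es_def m_def)
  show "integrable (gauss I) (\<lambda>z. 1 / rss (covariates S) (C A) z)"
    using int_q by (simp add: q_def es_def)
qed

section \<open>Moments of the least squares estimator\<close>

lemma integrable_obs_obs:
  assumes "s < n" "t < n"
  shows "integrable (gauss I) (\<lambda>z. obs f z s * obs e z t)"
    "(\<integral>z. obs f z s * obs e z t \<partial>gauss I) = (if s = t then lin_form V f e else 0)"
    "integrable (gauss I) (\<lambda>z. obs f z s)" "(\<integral>z. obs f z s \<partial>gauss I) = 0"
proof -
  interpret prob_space "gauss I" by (rule prob_space_gauss)
  have 1: "integrable (gauss I) (\<lambda>_. 1 :: real)" "invariant I c (\<lambda>_. 1 :: real)" for c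
    by (simp_all add: invariant_def)
  from integral_invariant_lin_form_lin_form[OF finite_I this(1) this(2) this(2), of "row_form s f" "row_form t e"] assms
  show "integrable (gauss I) (\<lambda>z. obs f z s * obs e z t)"
    "(\<integral>z. obs f z s * obs e z t \<partial>gauss I) = (if s = t then lin_form V f e else 0)"
    by (simp_all add: lin_form_row row_row prob_space)
  from integral_invariant_lin_form[OF finite_I 1, of "row_form s f"] assms
  show "integrable (gauss I) (\<lambda>z. obs f z s)" "(\<integral>z. obs f z s \<partial>gauss I) = 0"
    by (simp_all add: lin_form_row)
qed

text \<open>\<open>T\<close> is the sum of the noise terms with weights r_t / q, and the weights are
  invariant under translation along \<open>w\<close> in every row. So the mean is 0. In the second
  moment the pairs of distinct rows drop out, their directions being orthogonal, and the diagonal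
  adds up to <w, w> times E(q / q^2).\<close>

lemma weighted_noise_moments:
  assumes es: "\<And>f. f \<in> set (a # es) \<Longrightarrow> lin_form V f w = 0"
    and pos: "AE z in gauss I. 0 < rss es a z"
    and int: "integrable (gauss I) (\<lambda>z. 1 / rss es a z)"
  defines "T \<equiv> \<lambda>z. dotn n (resid es a z) (obs w z) / rss es a z"
  shows "integrable (gauss I) T" "(\<integral>z. T z \<partial>gauss I) = 0"
    "integrable (gauss I) (\<lambda>z. (T z)\<^sup>2)"
    "(\<integral>z. (T z)\<^sup>2 \<partial>gauss I) = lin_form V w w * (\<integral>z. 1 / rss es a z \<partial>gauss I)"
proof -
  interpret prob_space "gauss I" by (rule prob_space_gauss)
  let ?r = "resid es a" and ?q = "rss es a"
  have design_inv: "design es (translate I (row_form t w) h z) = design es z" for t h z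
    by (rule design_translate) (simp add: es)
  have r_inv: "?r (translate I (row_form t w) h z) s = ?r z s" if "t < n" for t h z s
    using resid_translate[of es w t a h z s] es that by simp
  have q_inv: "?q (translate I (row_form t w) h z) = ?q z" if "t < n" for t h z
    unfolding rss_def dotn_def using r_inv[OF that] by simp
  \<comment> \<open>Integrability is known for 1/q alone; the bounds \<open>r_le\<close> and
    \<open>rr_le\<close> reduce the weights r/q and r r/q^2 to it and to constants.\<close>
  have r_le: "\<bar>?r z t\<bar> \<le> 1 + ?q z" if "t < n" for z t
  proof -
    have "2 * \<bar>?r z t\<bar> \<le> 1 + (?r z t)\<^sup>2"
      using sum_squares_bound[of 1 "\<bar>?r z t\<bar>"] by simp
    then show ?thesis using resid_le_rss[OF that, of es a z] rss_nonneg[of es a z] by linarith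
  qed
  have rr_le: "\<bar>?r z s * ?r z t\<bar> \<le> ?q z" if "s < n" "t < n" for z s t
  proof -
    have "2 * \<bar>?r z s * ?r z t\<bar> \<le> (?r z s)\<^sup>2 + (?r z t)\<^sup>2"
      using sum_squares_bound[of "\<bar>?r z s\<bar>" "\<bar>?r z t\<bar>"] by (simp add: abs_mult)
    then show ?thesis using resid_le_rss[OF that(1), of es a z] resid_le_rss[OF that(2), of es a z] by linarith
  qed
  have int1: "integrable (gauss I) (\<lambda>z. ?r z t / ?q z)" if "t < n" for t
  proof (rule Bochner_Integration.integrable_bound)
    show "integrable (gauss I) (\<lambda>z. 1 / ?q z + 1)" using int by simp
    show "AE z in gauss I. norm (?r z t / ?q z) \<le> norm (1 / ?q z + 1)"
      using pos
    proof eventually_elim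
      case (elim z)
      have "\<bar>?r z t\<bar> / ?q z \<le> (1 + ?q z) / ?q z" using r_le[OF that] elim by (intro divide_right_mono) auto
      then show ?case using elim by (simp add: add_divide_distrib abs_div)
    qed
  qed measurable
  have int2: "integrable (gauss I) (\<lambda>z. ?r z s * ?r z t / (?q z)\<^sup>2)" if "s < n" "t < n" for s t
  proof (rule Bochner_Integration.integrable_bound[OF int])
    show "AE z in gauss I. norm (?r z s * ?r z t / (?q z)\<^sup>2) \<le> norm (1 / ?q z)"
      using pos
    proof eventually_elim
      case (elim z)
      have "\<bar>?r z s * ?r z t\<bar> / (?q z)\<^sup>2 \<le> ?q z / (?q z)\<^sup>2" using rr_le[OF that] by (intro divide_right_mono) auto
      then show ?case using elim by (simp add: power2_eq_square abs_div)
    qed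
  qed measurable
  have m1: "integrable (gauss I) (\<lambda>z. ?r z t / ?q z * obs w z t)"
    "(\<integral>z. ?r z t / ?q z * obs w z t \<partial>gauss I) = 0" if "t \<in> {..<n}" for t
    using integral_invariant_lin_form[OF finite_I int1[of t], of "row_form t w"] that
    by (simp_all add: invariant_def lin_form_row r_inv q_inv)
  have m2: "integrable (gauss I) (\<lambda>z. ?r z s * ?r z t / (?q z)\<^sup>2 * obs w z s * obs w z t)"
    "(\<integral>z. ?r z s * ?r z t / (?q z)\<^sup>2 * obs w z s * obs w z t \<partial>gauss I)
      = (if s = t then lin_form V w w * (\<integral>z. ?r z s * ?r z t / (?q z)\<^sup>2 \<partial>gauss I) else 0)"
    if "s \<in> {..<n}" "t \<in> {..<n}" for s t
    using integral_invariant_lin_form_lin_form[OF finite_I int2[of s t], of "row_form t w" "row_form s w"] that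
    by (simp_all add: invariant_def lin_form_row r_inv q_inv row_row)
  have T1: "T z = (\<Sum>t<n. ?r z t / ?q z * obs w z t)" for z
    by (simp add: T_def dotn_def sum_divide_distrib)
  show "integrable (gauss I) T"
    unfolding T1[abs_def] using m1(1) by (rule Bochner_Integration.integrable_sum)
  have "(\<integral>z. T z \<partial>gauss I) = (\<Sum>t<n. \<integral>z. ?r z t / ?q z * obs w z t \<partial>gauss I)"
    unfolding T1 using m1(1) by (rule Bochner_Integration.integral_sum)
  also have "\<dots> = 0" using m1(2) by (intro sum.neutral ballI)
  finally show "(\<integral>z. T z \<partial>gauss I) = 0" .
  have T2: "(T z)\<^sup>2 = (\<Sum>s<n. \<Sum>t<n. ?r z s * ?r z t / (?q z)\<^sup>2 * obs w z s * obs w z t)" for z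
    unfolding T1 power2_eq_square sum_product by (intro sum.cong refl) (simp add: field_simps)
  show "integrable (gauss I) (\<lambda>z. (T z)\<^sup>2)"
    unfolding T2 using m2(1) by (intro Bochner_Integration.integrable_sum)
  have "(\<integral>z. (T z)\<^sup>2 \<partial>gauss I) = (\<Sum>s<n. \<Sum>t<n. \<integral>z. ?r z s * ?r z t / (?q z)\<^sup>2 * obs w z s * obs w z t \<partial>gauss I)"
    unfolding T2 using m2(1)
    by (subst Bochner_Integration.integral_sum) (intro Bochner_Integration.integrable_sum sum.cong refl Bochner_Integration.integral_sum; assumption)+
  also have "\<dots> = (\<Sum>s<n. lin_form V w w * (\<integral>z. ?r z s * ?r z s / (?q z)\<^sup>2 \<partial>gauss I))"
  proof (intro sum.cong refl)
    fix s assume s: "s \<in> {..<n}"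
    have "(\<Sum>t<n. \<integral>z. ?r z s * ?r z t / (?q z)\<^sup>2 * obs w z s * obs w z t \<partial>gauss I)
        = (\<Sum>t<n. if s = t then lin_form V w w * (\<integral>z. ?r z s * ?r z t / (?q z)\<^sup>2 \<partial>gauss I) else 0)"
      using m2(2)[OF s] by (rule sum.cong[OF refl])
    also have "\<dots> = lin_form V w w * (\<integral>z. ?r z s * ?r z s / (?q z)\<^sup>2 \<partial>gauss I)"
      using s by simp
    finally show "(\<Sum>t<n. \<integral>z. ?r z s * ?r z t / (?q z)\<^sup>2 * obs w z s * obs w z t \<partial>gauss I)
        = lin_form V w w * (\<integral>z. ?r z s * ?r z s / (?q z)\<^sup>2 \<partial>gauss I)" .
  qed
  also have "\<dots> = lin_form V w w * (\<integral>z. (\<Sum>s<n. ?r z s * ?r z s / (?q z)\<^sup>2) \<partial>gauss I)"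
    unfolding sum_distrib_left[symmetric] using int2 by (subst Bochner_Integration.integral_sum) auto
  also have "(\<integral>z. (\<Sum>s<n. ?r z s * ?r z s / (?q z)\<^sup>2) \<partial>gauss I) = (\<integral>z. 1 / ?q z \<partial>gauss I)"
  proof (intro Bochner_Integration.integral_cong refl)
    fix z
    \<comment> \<open>This also covers q = 0, where all terms are 0 by the convention on
      division.\<close>
    have "(\<Sum>s<n. ?r z s * ?r z s / (?q z)\<^sup>2) = ?q z / (?q z)\<^sup>2"
      unfolding sum_divide_distrib[symmetric] by (simp add: rss_def dotn_def)
    then show "(\<Sum>s<n. ?r z s * ?r z s / (?q z)\<^sup>2) = 1 / ?q z" by (simp add: power2_eq_square)
  qed
  finally show "(\<integral>z. (T z)\<^sup>2 \<partial>gauss I) = lin_form V w w * (\<integral>z. 1 / ?q z \<partial>gauss I)" .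
qed

text \<open>The mean is the population coefficient \<open>b A\<close> in the regression of Y on A
  and S with noise \<open>w\<close>. Pairing the sample version of that regression with the residual
  r of A kills the covariates and turns A into q, so almost surely \<open>est\<close> is
  \<open>b A\<close> plus <r, w> / q. The variance is then the product of var(w) and the inverse
  moment of q.\<close>

lemma ols_moments:
  assumes S: "S \<subseteq> V - {A, Y}" and AY: "A \<in> V" "Y \<in> V" "A \<noteq> Y" and n: "card S + 3 < n"
    and Sig: "\<And>u w. u \<in> V \<Longrightarrow> w \<in> V \<Longrightarrow> Sig u w = lin_form V (C u) (C w)"
  defines "est \<equiv> \<lambda>z. ols_coef n (\<lambda>t v. obs (C v) z t) A Y S"
  obtains \<tau> where "integrable (gauss I) est" "(\<integral>z. est z \<partial>gauss I) = \<tau>"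
    "integrable (gauss I) (\<lambda>z. (est z - \<tau>)\<^sup>2)"
    "(\<integral>z. (est z - \<tau>)\<^sup>2 \<partial>gauss I)
       = partial_cov Sig Y Y (insert A S) / partial_cov Sig A A S / (real n - real (card S) - 3)"
proof -
  interpret prob_space "gauss I" by (rule prob_space_gauss)
  have SV: "S \<subseteq> V" and AS: "A \<notin> S" and YS: "Y \<notin> insert A S" and ASV: "insert A S \<subseteq> V"
    using S AY by auto
  have finS: "finite S" by (rule finite_subset[OF SV finite_V])
  define es where "es = covariates S"
  define q where "q = rss es (C A)"
  define r where "r = resid es (C A)"
  obtain d where d: "\<And>x. x \<in> S \<Longrightarrow> lin_form V (\<lambda>i. C A i - (\<Sum>u\<in>S. d u * C u i)) (C x) = 0"
    "lin_form V (\<lambda>i. C A i - (\<Sum>u\<in>S. d u * C u i)) (C A) = partial_cov Sig A A S" "0 < partial_cov Sig A A S"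
    using population_regression[OF finite_V indep Sig SV AY(1) AS] by blast
  have inv: "integrable (gauss I) (\<lambda>z. 1 / rss es (C A) z)"
    "(\<integral>z. 1 / rss es (C A) z \<partial>gauss I) = 1 / (partial_cov Sig A A S * (real n - real (card S) - 3))"
    using inverse_rss_moment[of S A d "partial_cov Sig A A S", OF SV AY(1) AS n d] by (simp_all only: es_def)
  obtain b where b: "\<And>x. x \<in> insert A S \<Longrightarrow> lin_form V (\<lambda>i. C Y i - (\<Sum>u\<in>insert A S. b u * C u i)) (C x) = 0"
    "lin_form V (\<lambda>i. C Y i - (\<Sum>u\<in>insert A S. b u * C u i)) (C Y) = partial_cov Sig Y Y (insert A S)"
    using population_regression[OF finite_V indep Sig ASV AY(2) YS] by blast
  define w where "w = (\<lambda>i. C Y i - (\<Sum>u\<in>insert A S. b u * C u i))"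
  have w_orth: "lin_form V w (C x) = 0" if "x \<in> insert A S" for x
    unfolding w_def by (rule b(1)[OF that])
  have ww: "lin_form V w w = partial_cov Sig Y Y (insert A S)"
  proof -
    have "lin_form V w w = lin_form V (C Y) w - (\<Sum>u\<in>insert A S. b u * lin_form V (C u) w)"
      by (subst w_def) (simp only: lin_form_diff_left lin_form_sum_left)
    also have "(\<Sum>u\<in>insert A S. b u * lin_form V (C u) w) = 0"
    proof (intro sum.neutral ballI)
      fix u assume "u \<in> insert A S"
      then have "lin_form V (C u) w = 0" using w_orth[of u] by (subst lin_form_commute)
      then show "b u * lin_form V (C u) w = 0" by simp
    qed
    also have "lin_form V (C Y) w = lin_form V w (C Y)" by (rule lin_form_commute)
    finally show ?thesis using b(2) by (simp add: w_def)
  qed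
  have w: "lin_form V f w = 0" if f: "f \<in> set (C A # es)" for f
  proof -
    obtain x where x: "x \<in> insert A S" "f = C x" using f finS by (auto simp: es_def)
    show ?thesis unfolding x(2) using w_orth[OF x(1)] by (subst lin_form_commute)
  qed
  have sr: "successive_residuals (C A # es)"
    unfolding es_def by (rule successive_residuals_covariates[OF SV AY(1) AS])
  have ok: "AE z in gauss I. gs_ok n (design (C A # es) z)"
    by (rule AE_gs_ok[OF sr]) (use n in \<open>simp add: es_def\<close>)
  have pos: "AE z in gauss I. 0 < q z"
    unfolding q_def by (rule AE_rss_pos[OF sr]) (use n in \<open>simp add: es_def\<close>)
  define T where "T z = dotn n (r z) (obs w z) / q z" for z
  have T: "integrable (gauss I) T" "(\<integral>z. T z \<partial>gauss I) = 0" "integrable (gauss I) (\<lambda>z. (T z)\<^sup>2)"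
    "(\<integral>z. (T z)\<^sup>2 \<partial>gauss I) = lin_form V w w * (\<integral>z. 1 / q z \<partial>gauss I)"
    using weighted_noise_moments[OF w pos[unfolded q_def] inv(1)]
    unfolding T_def[abs_def] r_def q_def by blast+
  have est_eq: "AE z in gauss I. est z = T z + b A"
    using ok pos
  proof eventually_elim
    case (elim z)
    have fs: "design es z = map (\<lambda>k t. obs (C k) z t) (sorted_list_of_set S) @ [\<lambda>_. 1]"
      by (simp add: design_def cols_def es_def)
    have "est z = dotn n (r z) (obs (C Y) z) / q z"
      using ols_coef_eq[of n "\<lambda>t v. obs (C v) z t" A S Y] elim(1)
      unfolding design_Cons fs[symmetric] est_def r_def q_def rss_def resid_def by simp
    also have "dotn n (r z) (obs (C Y) z) = dotn n (r z) (obs w z) + b A * q z"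
    proof -
      have "dotn n (r z) (obs w z) = dotn n (r z) (\<lambda>t. obs (C Y) z t - (\<Sum>u\<in>insert A S. b u * obs (C u) z t) * 1)"
        unfolding w_def by (intro dotn_cong) (simp_all only: obs_combination mult_1_right)
      also have "\<dots> = dotn n (r z) (obs (C Y) z) - (\<Sum>u\<in>insert A S. b u * dotn n (r z) (obs (C u) z))"
        unfolding dotn_diff_scale dotn_sum_right by simp
      also have "(\<Sum>u\<in>insert A S. b u * dotn n (r z) (obs (C u) z)) = b A * q z"
      proof -
        have "(\<Sum>u\<in>S. b u * dotn n (r z) (obs (C u) z)) = 0"
          by (intro sum.neutral ballI) (simp add: r_def es_def resid_covariate[OF SV])
        then show ?thesis using finS AS by (simp add: r_def q_def resid_obs)
      qed
      finally show ?thesis by simp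
    qed
    finally show ?case using elim(2) by (simp add: T_def add_divide_distrib)
  qed
  have em [measurable]: "est \<in> borel_measurable (gauss I)"
    unfolding est_def by (rule ols_coef_measurable) (rule obs_measurable)
  have Tm [measurable]: "T \<in> borel_measurable (gauss I)" using T(1) by (rule borel_measurable_integrable)
  have sq_eq: "AE z in gauss I. (est z - b A)\<^sup>2 = (T z)\<^sup>2"
    using est_eq by eventually_elim simp
  show thesis
  proof (rule that[of "b A"])
    have "integrable (gauss I) est \<longleftrightarrow> integrable (gauss I) (\<lambda>z. T z + b A)"
      using est_eq by (intro integrable_cong_AE) measurable
    then show "integrable (gauss I) est" using T(1) by simp
    have "(\<integral>z. est z \<partial>gauss I) = (\<integral>z. T z + b A \<partial>gauss I)"
      using est_eq by (intro integral_cong_AE) measurable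
    then show "(\<integral>z. est z \<partial>gauss I) = b A" using T(1,2) by (simp add: prob_space)
    have "integrable (gauss I) (\<lambda>z. (est z - b A)\<^sup>2) \<longleftrightarrow> integrable (gauss I) (\<lambda>z. (T z)\<^sup>2)"
      using sq_eq by (intro integrable_cong_AE) measurable
    then show "integrable (gauss I) (\<lambda>z. (est z - b A)\<^sup>2)" using T(3) by simp
    have "(\<integral>z. (est z - b A)\<^sup>2 \<partial>gauss I) = (\<integral>z. (T z)\<^sup>2 \<partial>gauss I)"
      using sq_eq by (intro integral_cong_AE) measurable
    also have "\<dots> = partial_cov Sig Y Y (insert A S) * (1 / (partial_cov Sig A A S * (real n - real (card S) - 3)))"
      unfolding T(4) ww q_def inv(2) ..
    finally show "(\<integral>z. (est z - b A)\<^sup>2 \<partial>gauss I)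
       = partial_cov Sig Y Y (insert A S) / partial_cov Sig A A S / (real n - real (card S) - 3)"
      by simp
  qed
qed

end

section \<open>From the given probability space to the standard Gaussian measure\<close>

lemma (in prob_space) distr_standardized_noise:
  fixes \<epsilon> :: "nat \<Rightarrow> 'v \<Rightarrow> 'a \<Rightarrow> real"
  assumes V: "V \<noteq> {}" and n: "0 < n" and \<sigma>: "\<And>v. v \<in> V \<Longrightarrow> 0 < \<sigma> v"
    and indep: "indep_vars (\<lambda>_. borel) (\<lambda>(t, v). \<epsilon> t v) ({..<n} \<times> V)"
    and normal: "\<And>t v. t < n \<Longrightarrow> v \<in> V \<Longrightarrow> distributed M lborel (\<epsilon> t v) (normal_density 0 (\<sigma> v))"
  defines "Z \<equiv> \<lambda>\<omega>. \<lambda>(t, v)\<in>{..<n} \<times> V. \<epsilon> t v \<omega> / \<sigma> v"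
  shows "Z \<in> measurable M (gauss ({..<n} \<times> V))" "distr M (gauss ({..<n} \<times> V)) Z = gauss ({..<n} \<times> V)"
proof -
  let ?I = "{..<n} \<times> V"
  let ?z = "\<lambda>i \<omega>. (case i of (t, v) \<Rightarrow> \<epsilon> t v) \<omega> / \<sigma> (snd i)"
  have Z: "Z = (\<lambda>\<omega>. \<lambda>i\<in>?I. ?z i \<omega>)"
    unfolding Z_def by (intro ext restrict_ext) auto
  have "indep_vars (\<lambda>_. borel) (\<lambda>i \<omega>. (\<lambda>x. x / \<sigma> (snd i)) ((case i of (t, v) \<Rightarrow> \<epsilon> t v) \<omega>)) ?I"
    by (rule indep_vars_compose2[OF indep]) measurable
  then have ind: "indep_vars (\<lambda>_. borel) ?z ?I" by simp
  have rv: "?z i \<in> borel_measurable M" if "i \<in> ?I" for i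
    using ind that by (auto simp: indep_vars_def)
  have distr: "distr M borel (?z i) = density lborel std_normal_density" if i: "i \<in> ?I" for i
  proof -
    obtain t v where tv: "i = (t, v)" "t < n" "v \<in> V" using i by auto
    have "distributed M lborel (\<lambda>\<omega>. (\<epsilon> t v \<omega> - 0) / \<sigma> v) std_normal_density"
      using normal[OF tv(2,3)] normal_standard_normal_convert[OF \<sigma>[OF tv(3)]] by blast
    then have "distr M lborel (?z i) = density lborel std_normal_density"
      by (simp add: tv(1) distributed_def)
    moreover have "distr M borel (?z i) = distr M lborel (?z i)" by (rule distr_cong) simp_all
    ultimately show ?thesis by simp
  qed
  show meas: "Z \<in> measurable M (gauss ?I)"
    unfolding Z measurable_cong_sets[OF refl sets_gauss] by (rule measurable_restrict) (rule rv)
  \<comment> \<open>The characterisation of independence by product laws requires a nonempty index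
    set, whence \<open>V \<noteq> {}\<close> and \<open>0 < n\<close>.\<close>
  have "?I \<noteq> {}" using V n by auto
  then have "distr M (PiM ?I (\<lambda>_. borel)) Z = PiM ?I (\<lambda>i. distr M borel (?z i))"
    unfolding Z using ind rv by (subst (asm) indep_vars_iff_distr_eq_PiM') auto
  also have "\<dots> = gauss ?I" unfolding gauss_def by (intro PiM_cong refl distr)
  finally show "distr M (gauss ?I) Z = gauss ?I"
    by (subst distr_cong[OF refl sets_gauss refl]) 
qed

section \<open>Comparison of the mean squared errors\<close>

theorem theorem1:
  fixes M :: "'a measure"
    and V :: "'v::linorder set" and E :: "('v \<times> 'v) set"
    and A Y :: 'v
    and \<beta> :: "'v \<Rightarrow> 'v \<Rightarrow> real" and \<sigma> :: "'v \<Rightarrow> real"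
    and n :: nat
    and \<epsilon> X :: "nat \<Rightarrow> 'v \<Rightarrow> 'a \<Rightarrow> real"
    and K L :: "'v set"
  assumes prob: "prob_space M"
    and dag: "is_dag V E"
    and AY: "A \<in> V" "Y \<in> V" "A \<noteq> Y" "(A, Y) \<in> E"
    and pretreat: "\<forall>v \<in> V - {A, Y}. v \<notin> descendants E A"
    and sig_pos: "\<forall>v\<in>V. \<sigma> v > 0"
    and eps_indep: "prob_space.indep_vars M (\<lambda>_. borel) (\<lambda>(t, v). \<epsilon> t v) ({..<n} \<times> V)"
    and eps_normal: "\<forall>t<n. \<forall>v\<in>V. distributed M lborel (\<epsilon> t v) (normal_density 0 (\<sigma> v))"
    and sem: "\<forall>t<n. \<forall>v\<in>V. \<forall>\<omega>\<in>space M.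
                X t v \<omega> = (\<Sum>u\<in>parents E v. \<beta> v u * X t u \<omega>) + \<epsilon> t v \<omega>"
    and faithful: "gaussian_faithful V E (\<lambda>u w. cov M (X 0 u) (X 0 w))"
    and KL: "K \<subseteq> V - {A, Y}" "L \<subseteq> V - {A, Y}"
    and nK: "card K + 3 < n" and nL: "card L + 3 < n"
    and bias_gt:
      "(prob_space.expectation M (\<lambda>\<omega>. ols_coef n (\<lambda>t v. X t v \<omega>) A Y K) - \<beta> Y A)\<^sup>2 >
       (prob_space.expectation M (\<lambda>\<omega>. ols_coef n (\<lambda>t v. X t v \<omega>) A Y L) - \<beta> Y A)\<^sup>2"
  shows
    "let \<tau> = \<beta> Y A;
         Sig = (\<lambda>u w. cov M (X 0 u) (X 0 w));
         tauhat = (\<lambda>S \<omega>. ols_coef n (\<lambda>t v. X t v \<omega>) A Y S);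
         B = (\<lambda>S. prob_space.expectation M (tauhat S) - \<tau>);
         aVar = (\<lambda>S. partial_cov Sig Y Y (insert A S) / partial_cov Sig A A S);
         MSE = (\<lambda>S. prob_space.expectation M (\<lambda>\<omega>. (tauhat S \<omega> - \<tau>)\<^sup>2));
         k = real (card K); l = real (card L)
     in MSE K < MSE L \<longleftrightarrow>
        real n < (aVar L - ((real n - l - 3) / (real n - k - 3)) * aVar K)
                 / ((B K)\<^sup>2 - (B L)\<^sup>2) + l + 3"
proof -
  interpret prob_space M by (rule prob)
  have finV: "finite V" using dag by (simp add: is_dag_def)
  interpret D: dag_weights V E \<beta> \<sigma> by unfold_locales (rule dag)
  define C where "C = D.noise_coef"
  interpret G: gaussian_sample V C n
    by unfold_locales (use finV D.lin_indep_noise_coef sig_pos in \<open>auto simp: C_def\<close>)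
  let ?N = "gauss G.I"
  have n: "0 < n" using nK by simp
  define Z where "Z = (\<lambda>\<omega>. \<lambda>(t, v)\<in>{..<n} \<times> V. \<epsilon> t v \<omega> / \<sigma> v)"
  have V0: "V \<noteq> {}" using AY(1) by blast
  have Z [measurable]: "Z \<in> measurable M ?N" and distr_Z: "distr M ?N Z = ?N"
    unfolding Z_def G.I_def using eps_indep sig_pos eps_normal
    by (intro distr_standardized_noise[OF V0 n]; simp)+
  have X: "X t v \<omega> = G.obs (C v) (Z \<omega>) t" if t: "t < n" and v: "v \<in> V" and \<omega>: "\<omega> \<in> space M" for t v \<omega>
  proof -
    have "X t v \<omega> = (\<Sum>i\<in>V. C v i * (\<epsilon> t i \<omega> / \<sigma> i))"
      unfolding C_def by (rule D.sem_solution[where x = "\<lambda>v. X t v \<omega>"]) (use sig_pos sem t v \<omega> in auto)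
    also have "\<dots> = G.obs (C v) (Z \<omega>) t"
      using t by (simp add: G.obs_def lin_form_def Z_def)
    finally show ?thesis .
  qed
  have transfer: "(\<integral>\<omega>. f (Z \<omega>) \<partial>M) = (\<integral>z. f z \<partial>?N)" "integrable M (\<lambda>\<omega>. f (Z \<omega>)) \<longleftrightarrow> integrable ?N f"
    if "f \<in> borel_measurable ?N" for f :: "(nat \<times> 'v \<Rightarrow> real) \<Rightarrow> real"
    using integral_distr[OF Z that] integrable_distr_eq[OF Z that] by (simp_all add: distr_Z)
  \<comment> \<open>Population covariances are read off observation 0, which belongs to the sample
    because 0 < n.\<close>
  define Sig where "Sig = (\<lambda>u w. cov M (X 0 u) (X 0 w))"
  have Sig: "Sig u w = lin_form V (C u) (C w)" if uw: "u \<in> V" "w \<in> V" for u w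
  proof -
    have E: "expectation (X 0 v) = 0" if "v \<in> V" for v
    proof -
      have "expectation (X 0 v) = (\<integral>\<omega>. G.obs (C v) (Z \<omega>) 0 \<partial>M)"
        using X[OF n that] by (intro Bochner_Integration.integral_cong refl)
      also have "\<dots> = (\<integral>z. G.obs (C v) z 0 \<partial>?N)" by (rule transfer(1)) measurable
      also have "\<dots> = 0" by (rule G.integrable_obs_obs(4)[OF n n])
      finally show ?thesis .
    qed
    have "Sig u w = (\<integral>\<omega>. G.obs (C u) (Z \<omega>) 0 * G.obs (C w) (Z \<omega>) 0 \<partial>M)"
      unfolding Sig_def cov_def E[OF uw(1)] E[OF uw(2)]
      using X[OF n uw(1)] X[OF n uw(2)] by (intro Bochner_Integration.integral_cong) simp_all
    also have "\<dots> = (\<integral>z. G.obs (C u) z 0 * G.obs (C w) z 0 \<partial>?N)"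
      by (rule transfer(1)) measurable
    also have "\<dots> = lin_form V (C u) (C w)" using G.integrable_obs_obs(2)[OF n n] by simp
    finally show ?thesis .
  qed
  define \<tau> where "\<tau> = \<beta> Y A"
  define tauhat where "tauhat = (\<lambda>S \<omega>. ols_coef n (\<lambda>t v. X t v \<omega>) A Y S)"
  define B where "B S = expectation (tauhat S) - \<tau>" for S
  define aVar where "aVar S = partial_cov Sig Y Y (insert A S) / partial_cov Sig A A S" for S
  define MSE where "MSE S = expectation (\<lambda>\<omega>. (tauhat S \<omega> - \<tau>)\<^sup>2)" for S
  have MSE: "MSE S = (B S)\<^sup>2 + aVar S / (real n - real (card S) - 3)"
    if S: "S \<subseteq> V - {A, Y}" and nS: "card S + 3 < n" for S
  proof -
    let ?est = "\<lambda>z. ols_coef n (\<lambda>t v. G.obs (C v) z t) A Y S"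
    obtain \<tau>' where m: "integrable ?N ?est" "(\<integral>z. ?est z \<partial>?N) = \<tau>'"
      "integrable ?N (\<lambda>z. (?est z - \<tau>')\<^sup>2)"
      "(\<integral>z. (?est z - \<tau>')\<^sup>2 \<partial>?N) = aVar S / (real n - real (card S) - 3)"
      using G.ols_moments[OF S AY(1,2,3) nS Sig] unfolding aVar_def by blast
    \<comment> \<open>\<open>X\<close> and \<open>obs\<close> agree only for t < n and variables in
      V, and \<open>ols_coef\<close> reads nothing else.\<close>
    have est: "tauhat S \<omega> = ?est (Z \<omega>)" if "\<omega> \<in> space M" for \<omega>
      unfolding tauhat_def
      by (rule ols_coef_cong) (use S AY finV that in \<open>auto intro!: X intro: finite_subset\<close>)
    have em [measurable]: "?est \<in> borel_measurable ?N" using m(1) by (rule borel_measurable_integrable)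
    have "expectation (tauhat S) = (\<integral>\<omega>. ?est (Z \<omega>) \<partial>M)"
      using est by (intro Bochner_Integration.integral_cong refl)
    also have "\<dots> = (\<integral>z. ?est z \<partial>?N)" by (rule transfer(1)) measurable
    also have "\<dots> = \<tau>'" by (rule m(2))
    finally have B: "B S = \<tau>' - \<tau>" by (simp add: B_def)
    interpret N: prob_space ?N by (rule prob_space_gauss)
    have "MSE S = (\<integral>\<omega>. (?est (Z \<omega>) - \<tau>)\<^sup>2 \<partial>M)"
      unfolding MSE_def using est by (intro Bochner_Integration.integral_cong refl) simp
    also have "\<dots> = (\<integral>z. (?est z - \<tau>)\<^sup>2 \<partial>?N)" by (rule transfer(1)) measurable
    \<comment> \<open>Bias-variance decomposition around the mean \<tau>'; the linear term
      integrates to 0.\<close>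
    also have "\<dots> = (\<integral>z. (?est z - \<tau>')\<^sup>2 + (2 * (\<tau>' - \<tau>) * (?est z - \<tau>') + (\<tau>' - \<tau>)\<^sup>2) \<partial>?N)"
      by (intro Bochner_Integration.integral_cong refl) (simp add: power2_eq_square algebra_simps)
    also have "\<dots> = (\<integral>z. (?est z - \<tau>')\<^sup>2 \<partial>?N) + (2 * (\<tau>' - \<tau>) * ((\<integral>z. ?est z \<partial>?N) - \<tau>') + (\<tau>' - \<tau>)\<^sup>2)"
      using m(1,3) by (simp add: N.prob_space)
    also have "\<dots> = (B S)\<^sup>2 + aVar S / (real n - real (card S) - 3)"
      unfolding m(2,4) B by simp
    finally show ?thesis .
  qed
  have b: "0 < (B K)\<^sup>2 - (B L)\<^sup>2"
    using bias_gt by (simp add: B_def tauhat_def \<tau>_def)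
  define k l where "k = real (card K)" and "l = real (card L)"
  have k: "0 < real n - k - 3" and l: "0 < real n - l - 3"
    using nK nL by (simp_all add: k_def l_def)
  \<comment> \<open>Only the denominator belonging to L is cleared, so the ratio of the two
    denominators stays and the final bound on n still contains n on its right-hand side.\<close>
  have "MSE K < MSE L \<longleftrightarrow> (B K)\<^sup>2 - (B L)\<^sup>2 < aVar L / (real n - l - 3) - aVar K / (real n - k - 3)"
    unfolding MSE[OF KL(1) nK] MSE[OF KL(2) nL] k_def l_def by linarith
  also have "\<dots> \<longleftrightarrow> (real n - l - 3) * ((B K)\<^sup>2 - (B L)\<^sup>2) < (real n - l - 3) * (aVar L / (real n - l - 3) - aVar K / (real n - k - 3))"
    using l by simp
  also have "(real n - l - 3) * (aVar L / (real n - l - 3) - aVar K / (real n - k - 3)) = aVar L - (real n - l - 3) / (real n - k - 3) * aVar K"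
    using l by (simp add: right_diff_distrib)
  also have "(real n - l - 3) * ((B K)\<^sup>2 - (B L)\<^sup>2) < \<dots> \<longleftrightarrow>
      real n - l - 3 < (aVar L - (real n - l - 3) / (real n - k - 3) * aVar K) / ((B K)\<^sup>2 - (B L)\<^sup>2)"
    using b by (rule pos_less_divide_eq[symmetric])
  also have "\<dots> \<longleftrightarrow> real n < (aVar L - (real n - l - 3) / (real n - k - 3) * aVar K) / ((B K)\<^sup>2 - (B L)\<^sup>2) + l + 3"
    by linarith
  finally show ?thesis
    unfolding Let_def B_def aVar_def MSE_def tauhat_def \<tau>_def k_def l_def Sig_def .
qed

end
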